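(* Let $f(x)$ be a real polynomial of degree $k$ with irrational leading coefficient, and let $\gamma=4^{1-k}$. Let $\epsilon>0$. Then there are infinitely many squarefree positive integers $n$ having at least two prime factors such that $$\|f(n)\|<n^{-\gamma/4+\epsilon}.$$
   Context: $\|x\|$ denotes the distance from the real number $x$ to the nearest integer. *)

theory Defs
  imports Complex_Main "HOL-Computational_Algebra.Computational_Algebra"
begin

definition dist_nearest_int :: "real \<Rightarrow> real" where
  "dist_nearest_int x = \<bar>x - of_int (round x)\<bar>"

end

theory Submission
  imports Defs "HOL-Analysis.Analysis"
begin

text \<open>
  The numbers \<open>n = 4 m + 2\<close> with \<open>m \<ge> 1\<close> have an odd prime factor besides 2, and such an \<open>n\<close> fails to
  be squarefree only if \<open>d\<^sup>2\<close> divides it for some odd \<open>d \<ge> 3\<close>. Since the sum of \<open>1 / d\<^sup>2\<close> over these \<open>d\<close>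
  is at most \<open>1 / 4\<close>, they can be sieved out without loss of the main term: a trigonometric
  polynomial of degree about \<open>L\<close> that is positive only where \<open>\<parallel>x\<parallel> < 1 / L\<close>, but whose mean is at least
  half that of a nonnegative majorant, yields a solution of \<open>\<parallel>f(n)\<parallel> < 1 / L\<close> as soon as the exponential
  sums over the progressions \<open>d\<^sup>2 | 4 m + 2\<close> with \<open>d \<le> 8 L + 1\<close> are small; larger \<open>d\<close> are handled
  trivially.

  For these sums Weyl differencing is applied with \<open>m\<close> of size \<open>q\<^sup>2\<close>, where \<open>q\<close> is a denominator with
  \<open>\<bar>\<alpha> - a / q\<bar> \<le> 1 / q\<^sup>2\<close> for the leading coefficient \<open>\<alpha>\<close>. The factor \<open>d\<^sup>2\<^sup>k\<close> that the progression
  introduces into the leading coefficient is compensated by its shorter length. Averaged over the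
  frequencies up to \<open>L\<close>, the saving is \<open>q\<close> to the power \<open>2\<^sup>1\<^sup>-\<^sup>k\<close>, whereas the argument needs \<open>L\<^sup>2\<close>;
  this allows \<open>L\<close> up to \<open>n\<close> to the power \<open>4\<^sup>-\<^sup>k - \<epsilon>\<close>.
\<close>

section \<open>Distance to the nearest integer\<close>

lemma dist_nearest_int_le: "dist_nearest_int x \<le> \<bar>x - of_int m\<bar>"
  unfolding dist_nearest_int_def by (rule round_diff_minimal)

lemma dist_nearest_int_le_half: "dist_nearest_int x \<le> 1 / 2"
  unfolding dist_nearest_int_def using of_int_round_abs_le[of x] by linarith

lemma dist_nearest_int_triangle: "dist_nearest_int (x + y) \<le> dist_nearest_int x + \<bar>y\<bar>"
  using dist_nearest_int_le[of "x + y" "round x"] by (simp add: dist_nearest_int_def)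

lemma dist_nearest_int_rat:
  fixes a m :: int and q :: nat
  assumes "q > 0" "\<not> int q dvd m"
  shows "dist_nearest_int (of_int m / real q) \<ge> 1 / real q"
proof -
  define z where "z = round (of_int m / real q :: real)"
  have "m - z * int q \<noteq> 0" using assms(2) by auto
  then have "\<bar>m - z * int q\<bar> \<ge> 1" by linarith
  then have "\<bar>of_int m - of_int z * real q\<bar> \<ge> 1"
    by (metis (mono_tags, opaque_lifting) of_int_1_le_iff of_int_abs of_int_diff of_int_mult of_int_of_nat_eq)
  then have "1 / real q \<le> \<bar>of_int m - of_int z * real q\<bar> / real q"
    by (intro divide_right_mono) auto
  also have "\<dots> = \<bar>(of_int m - of_int z * real q) / real q\<bar>" by simp
  also have "(of_int m - of_int z * real q) / real q = of_int m / real q - of_int z"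
    using assms(1) by (simp add: diff_divide_distrib)
  finally show ?thesis unfolding dist_nearest_int_def z_def[symmetric] .
qed

text \<open>The usual \<open>min (B, 1 / \<parallel>x\<parallel>)\<close>, written so that an integer \<open>x\<close> yields \<open>B\<close>.\<close>
definition capped_recip :: "real \<Rightarrow> real \<Rightarrow> real" where
  "capped_recip B x = 1 / max (1 / B) (dist_nearest_int x)"

lemma capped_recip_pos: "B > 0 \<Longrightarrow> capped_recip B x > 0"
  by (simp add: capped_recip_def less_max_iff_disj)

lemma capped_recip_le: "B > 0 \<Longrightarrow> capped_recip B x \<le> B"
  using frac_le[of 1 1 "1/B" "max (1/B) (dist_nearest_int x)"] by (simp add: capped_recip_def)

lemma capped_recip_le_inverse:
  assumes "c > 0" "c \<le> dist_nearest_int x"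
  shows "capped_recip B x \<le> 1 / c"
  unfolding capped_recip_def using assms by (intro frac_le) auto

text \<open>Joins the two estimates of a geometric sum, the trivial bound \<open>B\<close> and the
  one from its closed form, into a single inequality.\<close>

lemma capped_recip_geI:
  assumes "B > 0" "a \<le> B" "a * dist_nearest_int x \<le> 1"
  shows "a \<le> capped_recip B x"
proof (cases "1 / B \<le> dist_nearest_int x")
  case True
  then have "dist_nearest_int x > 0" using assms(1) by (auto intro: less_le_trans[of 0 "1 / B"])
  then show ?thesis using True assms(3) by (simp add: capped_recip_def max_absorb2 pos_le_divide_eq)
next
  case False
  then show ?thesis using assms(1,2) by (simp add: capped_recip_def max_absorb1)
qed

text \<open>Since \<open>q\<close> does not divide \<open>r * a\<close>, the fraction
  \<open>r a / q\<close> is at distance at least \<open>1 / q\<close> from the integers. Replacing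
  \<open>a / q\<close> by \<alpha> moves it by at most \<open>r / q ^ 2\<close>, which is at most
  half of that because \<open>2 * r \<le> q\<close>.\<close>

lemma dist_nearest_int_mult_ge:
  fixes a :: int and q r :: nat
  assumes "coprime a (int q)" "\<bar>\<alpha> - of_int a / real q\<bar> \<le> 1 / real q ^ 2" "0 < r" "2 * r \<le> q"
  shows "dist_nearest_int (real r * \<alpha>) \<ge> 1 / (2 * real q)"
proof -
  have q: "q > 0" using assms by linarith
  have "\<not> int q dvd int r * a"
  proof
    assume "int q dvd int r * a"
    then have "int q dvd int r"
      using assms(1) by (simp add: coprime_dvd_mult_left_iff coprime_commute)
    then have "q dvd r" by simp
    then show False using assms(3,4) by (auto dest: dvd_imp_le)
  qed
  from dist_nearest_int_rat[OF q this]
  have 1: "1 / real q \<le> dist_nearest_int (real r * (of_int a / real q))" by simp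
  have "dist_nearest_int (real r * (of_int a / real q))
        \<le> dist_nearest_int (real r * \<alpha>) + \<bar>real r * (of_int a / real q - \<alpha>)\<bar>"
    using dist_nearest_int_triangle[of "real r * \<alpha>" "real r * (of_int a / real q - \<alpha>)"]
    by (simp add: algebra_simps)
  moreover have "\<bar>real r * (of_int a / real q - \<alpha>)\<bar> \<le> real r * (1 / real q ^ 2)"
    using assms(2) by (simp only: abs_mult abs_of_nat) (intro mult_left_mono, auto simp: abs_minus_commute)
  moreover have "real r * (1 / real q ^ 2) \<le> real q / 2 * (1 / real q ^ 2)"
    using assms(4) by (intro mult_right_mono) auto
  moreover have "real q / 2 * (1 / real q ^ 2) = 1 / (2 * real q)"
    using q by (simp add: power2_eq_square)
  moreover have "1 / real q - 1 / (2 * real q) = 1 / (2 * real q)" by simp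
  ultimately show ?thesis using 1 by linarith
qed

section \<open>Sums of reciprocal distances along the multiples of a real number\<close>

lemma harmonic_sum_le:
  assumes "n > 0"
  shows "(\<Sum>i=1..n. 1 / real i) \<le> 1 + ln (real n)"
  using assms
proof (induction n rule: nat_induct_non_zero)
  case (Suc n)
  have "1 / real (Suc n) \<le> ln (real (Suc n) / real n)"
  proof -
    have "ln (real n / real (Suc n)) \<le> real n / real (Suc n) - 1"
      using Suc by (intro ln_le_minus_one) auto
    moreover have "ln (real n / real (Suc n)) = - ln (real (Suc n) / real n)"
      using Suc by (simp add: ln_div)
    moreover have "real n / real (Suc n) - 1 = - (1 / real (Suc n))" by (simp add: field_simps)
    ultimately show ?thesis by linarith
  qed
  then show ?case using Suc by (simp add: ln_div)
qed simp

text \<open>Within a block of length about \<open>q / 2\<close> the points \<open>s \<alpha>\<close> are \<open>1 / (2 q)\<close>-separated modulo 1, so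
  each of the intervals \<open>[i / (2 q), (i + 1) / (2 q))\<close> contains at most one of them.\<close>
lemma sum_capped_recip_block:
  fixes a :: int and q :: nat
  assumes "coprime a (int q)" "\<bar>\<alpha> - of_int a / real q\<bar> \<le> 1 / real q ^ 2" "q > 0" "B > 0"
    and T: "T \<subseteq> {s0..<s0 + l}" "2 * l \<le> q + 1"
  shows "(\<Sum>s\<in>T. capped_recip B (real s * \<alpha>)) \<le> 2 * B + 4 * real q * (1 + ln (real q))"
proof -
  define x where "x s = real s * \<alpha> - of_int (round (real s * \<alpha>))" for s :: nat
  define j where "j s = \<lfloor>2 * real q * x s\<rfloor>" for s
  \<comment> \<open>A point in box \<open>i \<ge> 1\<close> has distance at least
    \<open>i / (2 q)\<close> from the integers, one in box \<open>i \<le> -2\<close> at least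
    \<open>(- i - 1) / (2 q)\<close>. Only the boxes 0 and -1, which touch the integer, need the cap
    \<open>B\<close>; they give the term \<open>2 * B\<close>, the others two harmonic sums.\<close>
  define w :: "int \<Rightarrow> real" where
    "w i = (if i \<ge> 1 then 2 * real q / of_int i else if i \<le> -2 then 2 * real q / of_int (- i - 1) else B)" for i
  have fin: "finite T" using T finite_subset by blast
  have neq: "j s \<noteq> j t" if st: "s < t" "s \<in> T" "t \<in> T" for s t
  proof
    assume "j s = j t"
    then have "\<bar>2 * real q * x s - 2 * real q * x t\<bar> < 1" unfolding j_def by linarith
    then have "2 * real q * \<bar>x t - x s\<bar> < 1"
      by (metis abs_minus_commute abs_mult abs_numeral abs_of_nat right_diff_distrib)
    then have "\<bar>x t - x s\<bar> < 1 / (2 * real q)" using assms(3) by (simp add: field_simps)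
    moreover have "dist_nearest_int (real (t - s) * \<alpha>) \<le> \<bar>x t - x s\<bar>"
      using dist_nearest_int_le[of "real (t - s) * \<alpha>" "round (real t * \<alpha>) - round (real s * \<alpha>)"] st
      by (simp add: x_def of_nat_diff algebra_simps)
    moreover have "dist_nearest_int (real (t - s) * \<alpha>) \<ge> 1 / (2 * real q)"
    proof (rule dist_nearest_int_mult_ge[OF assms(1,2)])
      \<comment> \<open>Two points of a block of \<open>l\<close> integers differ by at most
        \<open>l - 1\<close>, which is why \<open>2 * l \<le> q + 1\<close> is enough.\<close>
      have "s0 \<le> s" "t < s0 + l" using T(1) st by auto
      then show "2 * (t - s) \<le> q" using T(2) st(1) by linarith
    qed (use st in auto)
    ultimately show False by linarith
  qed
  have inj: "inj_on j T" using neq by (metis inj_onI linorder_neqE_nat)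
  have xb: "\<bar>x s\<bar> \<le> 1 / 2" for s
    using of_int_round_abs_le[of "real s * \<alpha>"] unfolding x_def by linarith
  have dx: "dist_nearest_int (real s * \<alpha>) = \<bar>x s\<bar>" for s by (simp add: x_def dist_nearest_int_def)
  have wj: "capped_recip B (real s * \<alpha>) \<le> w (j s)" for s
  proof -
    consider "j s \<ge> 1" | "j s \<le> -2" | "j s = 0 \<or> j s = -1" by linarith
    then show ?thesis
    proof cases
      case 1
      then have "of_int (j s) \<le> 2 * real q * x s" unfolding j_def by linarith
      then have "of_int (j s) / (2 * real q) \<le> \<bar>x s\<bar>" using assms(3) by (simp add: field_simps) (smt (verit) mult_left_mono of_nat_0_le_iff)
      then show ?thesis using 1 capped_recip_le_inverse[of "of_int (j s) / (2 * real q)" "real s * \<alpha>" B] assms(3)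
        by (simp add: w_def dx)
    next
      case 2
      then have "of_int (- j s - 1) \<le> 2 * real q * (- x s)" unfolding j_def by simp linarith
      also have "\<dots> \<le> 2 * real q * \<bar>x s\<bar>" by (intro mult_left_mono) auto
      finally have "of_int (- j s - 1) / (2 * real q) \<le> \<bar>x s\<bar>" using assms(3) by (simp add: field_simps)
      then show ?thesis using 2 capped_recip_le_inverse[of "of_int (- j s - 1) / (2 * real q)" "real s * \<alpha>" B] assms(3)
        by (simp add: w_def dx)
    next
      case 3
      then show ?thesis using capped_recip_le[OF assms(4)] by (auto simp: w_def)
    qed
  qed
  let ?U = "int ` {1..q} \<union> ((\<lambda>i. - int i - 1) ` {1..q} \<union> {0, -1})"
  have img: "j ` T \<subseteq> ?U"
  proof
    fix i assume "i \<in> j ` T"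
    then obtain s where s: "i = j s" by auto
    have "\<bar>2 * real q * x s\<bar> \<le> real q" using mult_left_mono[OF xb[of s], of "2 * real q"] by (simp add: abs_mult)
    then have "i \<le> int q" "i \<ge> - int q" unfolding s j_def by linarith+
    then show "i \<in> ?U"
      by (cases "i \<ge> 1"; cases "i \<le> -2")
         (auto intro!: image_eqI[of _ int "nat i"] image_eqI[of _ "\<lambda>i. - int i - 1" "nat (- i - 1)"])
  qed
  have wnn: "w i \<ge> 0" for i using assms(4) by (auto simp: w_def)
  have "(\<Sum>s\<in>T. capped_recip B (real s * \<alpha>)) \<le> (\<Sum>s\<in>T. w (j s))" by (intro sum_mono wj)
  also have "\<dots> = sum w (j ` T)" by (simp add: sum.reindex[OF inj])
  also have "\<dots> \<le> sum w ?U" by (intro sum_mono2 img wnn) auto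
  also have "\<dots> = sum w (int ` {1..q}) + (sum w ((\<lambda>i. - int i - 1) ` {1..q}) + sum w {0, -1})"
    by (subst sum.union_disjoint; (subst sum.union_disjoint)?) auto
  also have "sum w (int ` {1..q}) = (\<Sum>i=1..q. 2 * real q * (1 / real i))"
    by (subst sum.reindex) (auto simp: w_def intro!: sum.cong)
  also have "sum w ((\<lambda>i. - int i - 1) ` {1..q}) = (\<Sum>i=1..q. 2 * real q * (1 / real i))"
    by (subst sum.reindex) (auto simp: w_def inj_on_def intro!: sum.cong)
  also have "sum w {0, -1} = 2 * B" by (simp add: w_def)
  also have "(\<Sum>i=1..q. 2 * real q * (1 / real i)) = 2 * real q * (\<Sum>i=1..q. 1 / real i)"
    by (rule sum_distrib_left[symmetric])
  also have "2 * real q * (\<Sum>i=1..q. 1 / real i) \<le> 2 * real q * (1 + ln (real q))"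
    by (intro mult_left_mono harmonic_sum_le assms) auto
  finally show ?thesis by (simp add: algebra_simps)
qed

text \<open>The range is cut into blocks of length \<open>l\<close> about \<open>q / 2\<close>. All
  blocks after the first, at most \<open>2 S / q\<close> in number, are bounded by
  \<open>sum_capped_recip_block\<close>. In the first block every \<open>s > 0\<close> satisfies
  \<open>2 * s \<le> q\<close>, so its point has distance at least \<open>1 / (2 q)\<close> and the
  cap can be lowered to \<open>2 q\<close>; hence no isolated term \<open>B\<close> appears in the
  bound.\<close>

lemma sum_capped_recip_le:
  fixes a :: int and q S :: nat
  assumes "coprime a (int q)" "\<bar>\<alpha> - of_int a / real q\<bar> \<le> 1 / real q ^ 2" "q > 0" "B > 0"
  shows "(\<Sum>s=1..S. capped_recip B (real s * \<alpha>))
           \<le> 8 * (1 + ln (real q)) * (real S * B / real q + real S + real q)"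
proof -
  define l where "l = (q + 1) div 2"
  define lam where "lam = 1 + ln (real q)"
  define n where "n = S div l"
  \<comment> \<open>The value 0 at \<open>s = 0\<close> lets the blocks start at 0 without adding a
    term of size \<open>B\<close>.\<close>
  define g where "g s = (if s = 0 then 0 else capped_recip B (real s * \<alpha>))" for s :: nat
  have l: "q \<le> 2 * l" "2 * l \<le> q + 1" "l > 0" using assms(3) unfolding l_def by linarith+
  have lam: "lam \<ge> 1" using assms(3) by (simp add: lam_def)
  have g0: "g s \<ge> 0" for s using capped_recip_pos[OF assms(4)] by (auto simp: g_def less_imp_le)
  have "(\<Sum>s=1..S. capped_recip B (real s * \<alpha>)) = sum g {1..S}"
    by (intro sum.cong) (auto simp: g_def)
  also have "\<dots> \<le> sum g {..<Suc n * l}"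
  proof (intro sum_mono2)
    show "{1..S} \<subseteq> {..<Suc n * l}"
    proof
      fix s assume "s \<in> {1..S}"
      then have "s \<le> S" by simp
      also have "S < Suc n * l" using l(3) unfolding n_def by (simp add: dividend_less_div_times)
      finally show "s \<in> {..<Suc n * l}" by simp
    qed
  qed (auto simp: g0)
  also have "\<dots> = (\<Sum>m<Suc n. sum g {m * l..<m * l + l})" by (rule sum.nat_group[symmetric])
  also have "\<dots> = sum g {0..<l} + (\<Sum>m<n. sum g {Suc m * l..<Suc m * l + l})"
    by (subst sum.lessThan_Suc_shift) simp
  also have "sum g {0..<l} \<le> 8 * real q * lam"
  proof -
    have "sum g {0..<l} = (\<Sum>s\<in>{0..<0+l} - {0}. capped_recip B (real s * \<alpha>))"
      by (intro sum.mono_neutral_cong_right) (auto simp: g_def)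
    also have "\<dots> \<le> (\<Sum>s\<in>{0..<0+l} - {0}. capped_recip (2 * real q) (real s * \<alpha>))"
    proof (intro sum_mono)
      fix s assume "s \<in> {0..<0+l} - {0}"
      then have "0 < s" "2 * s \<le> q" using l by auto
      from dist_nearest_int_mult_ge[OF assms(1,2) this]
      have "1 / (2 * real q) \<le> dist_nearest_int (real s * \<alpha>)" .
      then show "capped_recip B (real s * \<alpha>) \<le> capped_recip (2 * real q) (real s * \<alpha>)"
        using assms(3) capped_recip_le_inverse[of "dist_nearest_int (real s * \<alpha>)" "real s * \<alpha>" B]
        by (simp add: capped_recip_def[of "2 * real q"] max_absorb2 less_le_trans[of 0 "1 / (2 * real q)"])
    qed
    also have "\<dots> \<le> 2 * (2 * real q) + 4 * real q * (1 + ln (real q))"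
      by (rule sum_capped_recip_block[OF assms(1-3)]) (use assms l in auto)
    also have "\<dots> = 4 * real q * 1 + 4 * real q * lam" by (simp add: lam_def)
    also have "\<dots> \<le> 4 * real q * lam + 4 * real q * lam" using lam by (intro add_right_mono mult_left_mono) auto
    finally show ?thesis by (simp add: algebra_simps)
  qed
  also have "(\<Sum>m<n. sum g {Suc m * l..<Suc m * l + l}) \<le> (\<Sum>m<n. 2 * B + 4 * real q * lam)"
  proof (intro sum_mono)
    fix m
    have "sum g {Suc m * l..<Suc m * l + l} = (\<Sum>s\<in>{Suc m * l..<Suc m * l + l}. capped_recip B (real s * \<alpha>))"
    proof (intro sum.cong refl)
      fix s assume "s \<in> {Suc m * l..<Suc m * l + l}"
      then have "l \<le> s" by simp
      then have "s > 0" using l(3) by linarith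
      then show "g s = capped_recip B (real s * \<alpha>)" by (simp add: g_def)
    qed
    also have "\<dots> \<le> 2 * B + 4 * real q * lam" unfolding lam_def
      by (rule sum_capped_recip_block[OF assms _ l(2)]) (rule order_refl)
    finally show "sum g {Suc m * l..<Suc m * l + l} \<le> 2 * B + 4 * real q * lam" .
  qed
  also have "(\<Sum>m<n. 2 * B + 4 * real q * lam) = real n * (2 * B + 4 * real q * lam)" by simp
  also have "real n * (2 * B + 4 * real q * lam) \<le> (2 * real S / real q) * (2 * B * lam + 4 * real q * lam)"
  proof (intro mult_mono)
    have "n * l \<le> S" unfolding n_def by simp
    then have "n * q \<le> 2 * S" using l(1) mult_le_mono2[OF l(1), of n] by linarith
    then have "real n * real q \<le> 2 * real S" by (metis of_nat_le_iff of_nat_mult of_nat_numeral)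
    then show "real n \<le> 2 * real S / real q" using assms(3) by (simp add: field_simps)
    have "2 * B * 1 \<le> 2 * B * lam" using lam assms(4) by (intro mult_left_mono) auto
    then show "2 * B + 4 * real q * lam \<le> 2 * B * lam + 4 * real q * lam" by simp
  qed (use assms lam in auto)
  also have "\<dots> = 4 * lam * (real S * B / real q) + 8 * lam * real S" using assms(3) by (simp add: field_simps)
  finally have "(\<Sum>s=1..S. capped_recip B (real s * \<alpha>))
     \<le> 8 * real q * lam + (4 * lam * (real S * B / real q) + 8 * lam * real S)" by simp
  moreover have "0 \<le> lam * (real S * B / real q)" using lam assms by auto
  moreover have "8 * lam * (real S * B / real q + real S + real q)
      = 8 * real q * lam + (8 * (lam * (real S * B / real q)) + 8 * lam * real S)"
    by (simp only: distrib_left mult_ac add_ac)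
  moreover have "4 * lam * (real S * B / real q) = 4 * (lam * (real S * B / real q))" by simp
  ultimately show ?thesis unfolding lam_def[symmetric] by linarith
qed

section \<open>The divisor bound\<close>

lemma card_divisors_mult_le:
  fixes m n :: nat
  assumes "m > 0" "n > 0"
  shows "card {d. d dvd m * n} \<le> card {d. d dvd m} * card {d. d dvd n}"
proof -
  have "{d. d dvd m * n} \<subseteq> (\<lambda>(x, y). x * y) ` ({d. d dvd m} \<times> {d. d dvd n})"
  proof
    fix d assume "d \<in> {d. d dvd m * n}"
    then obtain x y where "d = x * y" "x dvd m" "y dvd n" using division_decomp by blast
    then show "d \<in> (\<lambda>(x, y). x * y) ` ({d. d dvd m} \<times> {d. d dvd n})" by (intro image_eqI[of _ _ "(x, y)"]) auto
  qed
  moreover have "finite ({d. d dvd m} \<times> {d. d dvd n})"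
    using finite_divisors_nat[OF assms(1)] finite_divisors_nat[OF assms(2)] by (rule finite_cartesian_product)
  ultimately have "card {d. d dvd m * n} \<le> card ({d. d dvd m} \<times> {d. d dvd n})"
    by (intro surj_card_le)
  then show ?thesis by (simp only: card_cartesian_product)
qed

lemma card_divisors_prime_power:
  fixes p :: nat
  assumes "prime p"
  shows "card {d. d dvd p ^ a} = a + 1"
proof -
  have "{d. d dvd p ^ a} = (\<lambda>i. p ^ i) ` {..a}"
    using divides_primepow_nat[OF assms] by auto
  moreover have "inj_on (\<lambda>i. p ^ i) {..a}"
    using prime_gt_1_nat[OF assms] by (auto simp: inj_on_def)
  ultimately show ?thesis by (simp add: card_image)
qed

text \<open>By multiplicativity it suffices to compare \<open>a + 1\<close> with
  \<open>p ^ a\<close> to the power \<eta>. If \<open>p\<close> to the power \<eta> is at least 2,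
  then \<open>a + 1 \<le> 2 ^ a\<close> is enough. Each of the finitely many smaller primes, those
  up to \<open>P\<close>, costs a factor \<open>C0\<close>. The induction splits off the full power
  of one prime factor.\<close>

lemma card_divisors_bound:
  fixes \<eta> :: real
  assumes "\<eta> > 0"
  obtains C where "C \<ge> 1" "\<And>n::nat. n > 0 \<Longrightarrow> real (card {d. d dvd n}) \<le> C * real n powr \<eta>"
proof -
  define P where "P = nat \<lceil>2 powr (1 / \<eta>)\<rceil>"
  \<comment> \<open>Chosen so that \<open>C0 * (\<eta> * ln 2) \<ge> 1\<close>; then
    \<open>a + 1\<close> is at most \<open>C0 * (1 + a * \<eta> * ln 2)\<close>, which the
    exponential series bounds by \<open>C0\<close> times \<open>2 powr (a * \<eta>)\<close>.\<close>
  define C0 where "C0 = max 1 (1 / (\<eta> * ln 2))"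
  define small where "small n = {p \<in> prime_factors n. p \<le> P}" for n :: nat
  have C0: "C0 \<ge> 1" by (simp add: C0_def)
  have pp: "real (a + 1) \<le> (if p \<le> P then C0 else 1) * real (p ^ a) powr \<eta>" if p: "prime p" for p a :: nat
  proof -
    have p2: "real p \<ge> 2" using prime_ge_2_nat[OF p] by simp
    have eq: "real (p ^ a) powr \<eta> = (real p powr \<eta>) ^ a"
      using p2 by (simp add: powr_power powr_realpow[symmetric] powr_powr mult.commute)
    show ?thesis
    proof (cases "p \<le> P")
      case True
      have "real (a + 1) \<le> C0 * (1 + real a * (\<eta> * ln 2))"
      proof -
        have "1 \<le> C0 * (\<eta> * ln 2)" using assms by (auto simp: C0_def max_def field_simps)
        from mult_left_mono[OF this, of "real a"] show ?thesis using C0 by (simp add: algebra_simps)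
      qed
      also have "1 + real a * (\<eta> * ln 2) \<le> exp (real a * (\<eta> * ln 2))" by (rule exp_ge_add_one_self)
      also have "exp (real a * (\<eta> * ln 2)) = (2 powr \<eta>) ^ a"
        by (simp add: powr_def exp_of_nat_mult)
      also have "(2 powr \<eta>) ^ a \<le> (real p powr \<eta>) ^ a"
        using p2 assms by (intro power_mono powr_mono2) auto
      finally show ?thesis using True C0 eq by simp
    next
      case False
      have "real (a + 1) \<le> 2 ^ a"
        by (induction a) auto
      also have "(2::real) \<le> real p powr \<eta>"
      proof -
        have "2 powr (1 / \<eta>) \<le> real p" using False unfolding P_def by linarith
        then have "(2 powr (1 / \<eta>)) powr \<eta> \<le> real p powr \<eta>" using assms by (intro powr_mono2) auto
        then show ?thesis using assms by (simp add: powr_powr)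
      qed
      then have "(2::real) ^ a \<le> (real p powr \<eta>) ^ a" by (intro power_mono) auto
      finally show ?thesis using False eq by simp
    qed
  qed
  have main: "real (card {d. d dvd n}) \<le> C0 ^ card (small n) * real n powr \<eta>" if "n > 0" for n
    using that
  proof (induction n rule: less_induct)
    case (less n)
    show ?case
    proof (cases "n = 1")
      case True
      then show ?thesis by (simp add: small_def)
    next
      case False
      then obtain p where p: "prime p" "p dvd n" using prime_factor_nat by blast
      define a where "a = multiplicity p n"
      obtain m where m: "n = p ^ a * m" "\<not> p dvd m"
        using multiplicity_decompose'[of n p] less.prems p unfolding a_def
        by (metis not_prime_unit not_gr_zero)
      have a: "a > 0" using p less.prems unfolding a_def
        by (simp add: prime_multiplicity_gt_zero_iff)
      have m0: "m > 0" using m less.prems by (cases m) auto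
      have "p ^ a > 1" using prime_gt_1_nat[OF p(1)] a by (intro one_less_power)
      then have "1 * m < p ^ a * m" using m0 by (rule mult_strict_right_mono)
      then have mn: "m < n" unfolding m(1) by simp
      have pf: "prime_factors n = insert p (prime_factors m)"
        unfolding m(1) using a m0 p(1) prime_gt_0_nat[OF p(1)]
        by (simp add: prime_factors_product prime_factorization_prime_power set_mset_replicate_mset_subset)
      have pm: "p \<notin> prime_factors m" using m(2) by auto
      have sm: "C0 ^ card (small n) = (if p \<le> P then C0 else 1) * C0 ^ card (small m)"
      proof (cases "p \<le> P")
        case True
        then have "small n = insert p (small m)" unfolding small_def pf by auto
        moreover have "p \<notin> small m" "finite (small m)" using pm unfolding small_def by auto
        ultimately show ?thesis using True by simp
      next
        case False
        then have "small n = small m" unfolding small_def pf by auto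
        then show ?thesis using False by simp
      qed
      have "card {d. d dvd n} \<le> card {d. d dvd p ^ a} * card {d. d dvd m}"
        unfolding m(1) using m0 prime_gt_0_nat[OF p(1)] by (intro card_divisors_mult_le) auto
      then have "real (card {d. d dvd n}) \<le> real (a + 1) * real (card {d. d dvd m})"
        unfolding card_divisors_prime_power[OF p(1)] by (metis of_nat_le_iff of_nat_mult)
      also have "\<dots> \<le> ((if p \<le> P then C0 else 1) * real (p ^ a) powr \<eta>) * (C0 ^ card (small m) * real m powr \<eta>)"
        using pp[OF p(1), of a] less.IH[OF mn m0] C0 by (intro mult_mono) auto
      also have "\<dots> = C0 ^ card (small n) * real n powr \<eta>"
      proof -
        have "real n powr \<eta> = real (p ^ a) powr \<eta> * real m powr \<eta>"
          unfolding m(1) of_nat_mult by (rule powr_mult)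
        then show ?thesis unfolding sm by (simp only: ac_simps)
      qed
      finally show ?thesis .
    qed
  qed
  show ?thesis
  proof
    show "1 \<le> C0 ^ (P + 1)" using C0 by (rule one_le_power)
    fix n :: nat assume n: "n > 0"
    have "card (small n) \<le> card {..P}" by (intro card_mono) (auto simp: small_def)
    then have "C0 ^ card (small n) \<le> C0 ^ (P + 1)" using C0 by (intro power_increasing) auto
    then have "C0 ^ card (small n) * real n powr \<eta> \<le> C0 ^ (P + 1) * real n powr \<eta>"
      by (intro mult_right_mono) auto
    then show "real (card {d. d dvd n}) \<le> C0 ^ (P + 1) * real n powr \<eta>" using main[OF n] by linarith
  qed
qed

section \<open>Weyl's inequality\<close>

text \<open>The sine is concave between 0 and \<open>pi / 2\<close>, so it lies above its chord
  there.\<close>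

lemma sin_pi_ge:
  fixes u :: real
  assumes "0 \<le> u" "u \<le> 1 / 2"
  shows "sin (pi * u) \<ge> 2 * u"
proof -
  have "convex_on {0..pi / 2} (\<lambda>x. - sin x)"
  proof (rule f''_ge0_imp_convex[where f' = "\<lambda>x. - cos x" and f'' = sin])
    show "0 \<le> sin x" if "x \<in> {0..pi / 2}" for x using that by (intro sin_ge_zero) auto
  qed (auto intro!: derivative_eq_intros)
  from convex_onD_Icc[OF this, of "2 * u"] assms
  have "- sin ((1 - 2 * u) * 0 + 2 * u * (pi / 2)) \<le> (1 - 2 * u) * - sin 0 + 2 * u * - sin (pi / 2)"
    by auto
  then show ?thesis by (simp add: mult.commute)
qed

lemma norm_cis_diff_1: "norm (cis (2 * pi * x) - 1) = 2 * \<bar>sin (pi * x)\<bar>"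
proof -
  have "(norm (cis (2 * pi * x) - 1))^2 = (2 * \<bar>sin (pi * x)\<bar>)^2"
  proof -
    have "(norm (cis (2 * pi * x) - 1))^2 = 2 - 2 * cos (2 * (pi * x))"
      using sin_cos_squared_add[of "2 * pi * x"]
      by (simp add: cmod_power2 power2_diff mult_ac)
    also have "\<dots> = 4 * sin (pi * x)^2" by (simp add: cos_double_sin)
    finally show ?thesis by (simp add: power2_eq_square)
  qed
  then show ?thesis by (rule power2_eq_imp_eq) auto
qed

lemma cis_2pi_add_int: "cis (2 * pi * (x + of_int m)) = cis (2 * pi * x)"
  using cis_mult[of "2 * pi * x" "2 * pi * of_int m"] cis_multiple_2pi[of "of_int m"]
  by (simp add: distrib_left)

lemma norm_cis_diff_1_ge: "norm (cis (2 * pi * x) - 1) \<ge> 4 * dist_nearest_int x"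
proof -
  define y where "y = x - of_int (round x)"
  have y: "dist_nearest_int x = \<bar>y\<bar>" by (simp add: y_def dist_nearest_int_def)
  have "cis (2 * pi * x) = cis (2 * pi * y)"
    using cis_2pi_add_int[of y "round x"] by (simp add: y_def)
  then have "norm (cis (2 * pi * x) - 1) = 2 * \<bar>sin (pi * y)\<bar>" by (simp add: norm_cis_diff_1)
  moreover have "\<bar>sin (pi * y)\<bar> = \<bar>sin (pi * \<bar>y\<bar>)\<bar>" by (cases "y \<ge> 0") auto
  moreover have "sin (pi * \<bar>y\<bar>) \<ge> 2 * \<bar>y\<bar>"
    using dist_nearest_int_le_half[of x] y by (intro sin_pi_ge) auto
  ultimately show ?thesis using y by linarith
qed

text \<open>The sum is geometric with ratio \<open>z\<close>: multiplied by \<open>z - 1\<close> it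
  has norm at most 2, and \<open>z - 1\<close> has norm at least four times the distance of \<theta>
  to the integers.\<close>

lemma norm_sum_cis_linear_le:
  assumes "B \<ge> real Y" "B > 0"
  shows "norm (\<Sum>t<Y. cis (2 * pi * (\<theta> * real t + b))) \<le> capped_recip B \<theta>"
proof (rule capped_recip_geI)
  define z where "z = cis (2 * pi * \<theta>)"
  have eq: "(\<Sum>t<Y. cis (2 * pi * (\<theta> * real t + b))) = cis (2 * pi * b) * (\<Sum>t<Y. z ^ t)"
    unfolding sum_distrib_left z_def
    by (intro sum.cong refl) (simp add: Complex.DeMoivre cis_mult algebra_simps)
  have n: "norm (\<Sum>t<Y. cis (2 * pi * (\<theta> * real t + b))) = norm (\<Sum>t<Y. z ^ t)"
    unfolding eq by (simp add: norm_mult)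
  have "norm (\<Sum>t<Y. z ^ t) \<le> (\<Sum>t<Y. norm (z ^ t))" by (rule norm_sum)
  also have "\<dots> = real Y" by (simp add: z_def norm_power)
  finally show "norm (\<Sum>t<Y. cis (2 * pi * (\<theta> * real t + b))) \<le> B" using n assms by simp
  have "(z - 1) * (\<Sum>t<Y. z ^ t) = z ^ Y - 1" by (rule power_diff_1_eq[symmetric])
  then have "norm (z - 1) * norm (\<Sum>t<Y. z ^ t) = norm (z ^ Y - 1)" by (metis norm_mult)
  also have "\<dots> \<le> norm (z ^ Y) + norm (1::complex)" by (rule norm_triangle_ineq4)
  also have "\<dots> = 2" by (simp add: z_def norm_power)
  finally have "norm (z - 1) * norm (\<Sum>t<Y. z ^ t) \<le> 2" .
  moreover have "4 * dist_nearest_int \<theta> * norm (\<Sum>t<Y. z ^ t) \<le> norm (z - 1) * norm (\<Sum>t<Y. z ^ t)"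
    unfolding z_def by (intro mult_right_mono norm_cis_diff_1_ge) auto
  ultimately show "norm (\<Sum>t<Y. cis (2 * pi * (\<theta> * real t + b))) * dist_nearest_int \<theta> \<le> 1"
    unfolding n by (simp add: mult_ac)
qed (use assms in auto)

text \<open>Weyl differencing: in the expanded square the pairs of indices are collected by their
  distance \<open>h\<close>, and the two orders of a pair are conjugate. Passing from
  \<open>Y\<close> to \<open>Suc Y\<close> adds to each \<open>h\<close> the one product that
  involves \<open>u Y\<close>. The identity serves both for exponential sums and for the Fourier
  expansion of the kernel.\<close>

lemma norm_sum_squared_eq:
  fixes u :: "nat \<Rightarrow> complex"
  shows "(norm (\<Sum>t<Y. u t))\<^sup>2 = (\<Sum>t<Y. (norm (u t))\<^sup>2)
           + 2 * Re (\<Sum>h\<in>{1..<Y}. \<Sum>t<Y - h. u (t + h) * cnj (u t))"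
proof (induction Y)
  case (Suc Y)
  have "(\<Sum>h\<in>{1..<Suc Y}. \<Sum>t<Suc Y - h. u (t + h) * cnj (u t))
      = (\<Sum>h\<in>{1..<Suc Y}. (\<Sum>t<Y - h. u (t + h) * cnj (u t)) + u Y * cnj (u (Y - h)))"
  proof (intro sum.cong refl)
    fix h assume "h \<in> {1..<Suc Y}"
    then have "Suc Y - h = Suc (Y - h)" "Y - h + h = Y" by auto
    then show "(\<Sum>t<Suc Y - h. u (t + h) * cnj (u t)) = (\<Sum>t<Y - h. u (t + h) * cnj (u t)) + u Y * cnj (u (Y - h))"
      by simp
  qed
  also have "\<dots> = (\<Sum>h\<in>{1..<Suc Y}. \<Sum>t<Y - h. u (t + h) * cnj (u t)) + (\<Sum>h\<in>{1..<Suc Y}. u Y * cnj (u (Y - h)))"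
    by (rule sum.distrib)
  also have "(\<Sum>h\<in>{1..<Suc Y}. \<Sum>t<Y - h. u (t + h) * cnj (u t)) = (\<Sum>h\<in>{1..<Y}. \<Sum>t<Y - h. u (t + h) * cnj (u t))"
    by (intro sum.mono_neutral_right) (auto simp: not_less)
  also have "(\<Sum>h\<in>{1..<Suc Y}. u Y * cnj (u (Y - h))) = u Y * cnj (\<Sum>t<Y. u t)"
    unfolding cnj_sum sum_distrib_left
    by (rule sum.reindex_bij_witness[of _ "\<lambda>t. Y - t" "\<lambda>h. Y - h"]) auto
  finally have eq: "(\<Sum>h\<in>{1..<Suc Y}. \<Sum>t<Suc Y - h. u (t + h) * cnj (u t))
    = (\<Sum>h\<in>{1..<Y}. \<Sum>t<Y - h. u (t + h) * cnj (u t)) + u Y * cnj (\<Sum>t<Y. u t)" .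
  have "(norm (a + b))\<^sup>2 = (norm a)\<^sup>2 + (norm b)\<^sup>2 + 2 * Re (b * cnj a)" for a b :: complex
    by (simp add: cmod_power2 power2_sum algebra_simps)
  from this[of "\<Sum>t<Y. u t" "u Y"] show ?case using Suc unfolding eq by (simp add: algebra_simps)
qed simp

lemma norm_sum_squared_le:
  fixes u :: "nat \<Rightarrow> complex"
  assumes "\<And>t. norm (u t) = 1"
  shows "(norm (\<Sum>t<Y. u t))\<^sup>2 \<le> real Y + 2 * (\<Sum>h\<in>{1..<Y}. norm (\<Sum>t<Y - h. u (t + h) * cnj (u t)))"
proof -
  have "Re (\<Sum>h\<in>{1..<Y}. \<Sum>t<Y - h. u (t + h) * cnj (u t)) \<le> norm (\<Sum>h\<in>{1..<Y}. \<Sum>t<Y - h. u (t + h) * cnj (u t))"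
    by (rule complex_Re_le_cmod)
  also have "\<dots> \<le> (\<Sum>h\<in>{1..<Y}. norm (\<Sum>t<Y - h. u (t + h) * cnj (u t)))" by (rule norm_sum)
  finally show ?thesis unfolding norm_sum_squared_eq by (simp add: assms)
qed

text \<open>The power mean inequality for the exponent \<open>2 ^ j\<close>, by iterating
  Cauchy-Schwarz. The extra factor \<open>card I\<close> on the left avoids the exponent
  \<open>2 ^ j - 1\<close>.\<close>

lemma sum_power_two_power_le:
  fixes f :: "'a \<Rightarrow> real"
  assumes "\<And>i. i \<in> I \<Longrightarrow> f i \<ge> 0"
  shows "real (card I) * (\<Sum>i\<in>I. f i) ^ (2 ^ j) \<le> real (card I) ^ (2 ^ j) * (\<Sum>i\<in>I. f i ^ (2 ^ j))"
  using assms
proof (induction j arbitrary: f)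
  case (Suc j)
  define N where "N = real (card I)"
  have nn: "0 \<le> (\<Sum>i\<in>I. f i)" "0 \<le> (\<Sum>i\<in>I. (f i)\<^sup>2)" using Suc.prems by (auto intro: sum_nonneg)
  have "N * (\<Sum>i\<in>I. f i) ^ (2 ^ Suc j) = N * ((\<Sum>i\<in>I. f i)\<^sup>2) ^ (2 ^ j)"
    by (simp add: power_mult[symmetric])
  also have "\<dots> \<le> N * ((\<Sum>i\<in>I. (f i)\<^sup>2) * N) ^ (2 ^ j)"
    unfolding N_def by (intro mult_left_mono power_mono sum_squared_le_sum_of_squares) auto
  also have "\<dots> = N ^ (2 ^ j) * (N * (\<Sum>i\<in>I. (f i)\<^sup>2) ^ (2 ^ j))" by (simp add: power_mult_distrib)
  also have "\<dots> \<le> N ^ (2 ^ j) * (N ^ (2 ^ j) * (\<Sum>i\<in>I. ((f i)\<^sup>2) ^ (2 ^ j)))"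
    unfolding N_def by (intro mult_left_mono Suc.IH) auto
  also have "\<dots> = N ^ (2 ^ Suc j) * (\<Sum>i\<in>I. f i ^ (2 ^ Suc j))"
    by (simp add: power_mult[symmetric] mult_2 power_add)
  finally show ?case unfolding N_def .
qed simp

text \<open>\<open>poly_phase k \<beta> P\<close> says that \<open>P\<close> behaves under differencing like a polynomial of degree \<open>k\<close>
  with leading coefficient \<open>\<beta>\<close> (possibly \<open>\<beta> = 0\<close>).\<close>
primrec poly_phase :: "nat \<Rightarrow> real \<Rightarrow> (nat \<Rightarrow> real) \<Rightarrow> bool" where
  "poly_phase 0 \<beta> P \<longleftrightarrow> (\<forall>t. P t = \<beta>)"
| "poly_phase (Suc k) \<beta> P \<longleftrightarrow> (\<forall>h. poly_phase k (real (Suc k) * real h * \<beta>) (\<lambda>t. P (t + h) - P t))"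

text \<open>Writing the polynomial as \<open>a + x p(x)\<close>, its shift is
  \<open>a + (x + h) s(x)\<close> with \<open>s\<close> the shift of \<open>p\<close>, so both
  claims follow from those for \<open>p\<close> in degree one less. The bound
  \<open>degree p \<le> n\<close> instead of equality lets the top coefficient vanish, as happens
  after differencing with \<open>h = 0\<close>.\<close>

lemma coeff_shift_diff:
  fixes p :: "real poly"
  assumes "degree p \<le> n"
  shows "coeff (pcompose p [:h, 1:]) n = coeff p n \<and>
    (\<forall>m. n = Suc m \<longrightarrow> coeff (pcompose p [:h, 1:] - p) m = real n * h * coeff p n)"
  using assms
proof (induction p arbitrary: n)
  case (pCons a p)
  define s where "s = pcompose p [:h, 1:]"
  have eq: "pcompose (pCons a p) [:h, 1:] = [:a:] + (smult h s + pCons 0 s)"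
    by (simp add: pcompose_pCons s_def)
  have deg: "degree s = degree p" by (simp add: s_def degree_pcompose)
  show ?case
  proof (cases "p = 0")
    case True
    then show ?thesis using pCons.prems by (cases n) (auto simp: coeff_pCons split: nat.splits)
  next
    case False
    then have "degree (pCons a p) = Suc (degree p)" by simp
    then obtain m where n: "n = Suc m" and m: "degree p \<le> m" using pCons.prems by (cases n) auto
    have sm: "coeff s m = coeff p m" using pCons.IH[OF m] by (simp add: s_def)
    have sn: "coeff s n = 0" "coeff p n = 0" using m n deg by (auto intro!: coeff_eq_0)
    show ?thesis
    proof (intro conjI allI impI)
      show "coeff (pcompose (pCons a p) [:h, 1:]) n = coeff (pCons a p) n"
        unfolding eq using n sm sn by (simp add: coeff_pCons)
      fix m' assume "n = Suc m'"
      then have m': "m' = m" using n by simp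
      show "coeff (pcompose (pCons a p) [:h, 1:] - pCons a p) m' = real n * h * coeff (pCons a p) n"
      proof (cases m)
        case 0
        then show ?thesis unfolding eq m' using n sm by (simp add: coeff_pCons)
      next
        case (Suc l)
        from pCons.IH[OF m] Suc have "coeff s l - coeff p l = real m * h * coeff p m" by (simp add: s_def)
        then show ?thesis unfolding eq m' using n Suc sm by (simp add: coeff_pCons algebra_simps)
      qed
    qed
  qed
qed simp

lemma poly_phase_poly:
  fixes p :: "real poly"
  assumes "degree p \<le> k"
  shows "poly_phase k (coeff p k) (\<lambda>t. poly p (real t))"
  using assms
proof (induction k arbitrary: p)
  case 0
  then obtain a where "p = [:a:]" by (metis degree_eq_zeroE le_zero_eq)
  then show ?case by simp
next
  case (Suc k)
  show ?case unfolding poly_phase.simps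
  proof
    fix h :: nat
    define d where "d = pcompose p [:real h, 1:] - p"
    have c: "coeff d k = real (Suc k) * real h * coeff p (Suc k)"
      using coeff_shift_diff[OF Suc.prems, of "real h"] by (simp add: d_def)
    have "degree d \<le> k"
    proof (rule degree_le, intro allI impI)
      fix i assume i: "k < i"
      show "coeff d i = 0"
      proof (cases "i = Suc k")
        case True
        then show ?thesis using coeff_shift_diff[OF Suc.prems, of "real h"] by (simp add: d_def)
      next
        case False
        then have "i > degree p" using i Suc.prems by simp
        then show ?thesis by (simp add: d_def degree_pcompose coeff_eq_0)
      qed
    qed
    from Suc.IH[OF this] show "poly_phase k (real (Suc k) * real h * coeff p (Suc k))
        (\<lambda>t. poly p (real (t + h)) - poly p (real t))"
      unfolding c by (simp add: d_def poly_pcompose add.commute)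
  qed
qed

text \<open>Written out, the sum of \<open>capped_recip X (h_1 ... h_j \<theta>)\<close> over all
  \<open>h_1, ..., h_j\<close> from 1 to \<open>X\<close>: what remains of an exponential sum after
  \<open>j\<close> differencing steps, when the phase has become linear.\<close>

primrec weyl_sum :: "nat \<Rightarrow> nat \<Rightarrow> real \<Rightarrow> real" where
  "weyl_sum X 0 \<theta> = capped_recip (real X) \<theta>"
| "weyl_sum X (Suc j) \<theta> = (\<Sum>h=1..X. weyl_sum X j (real h * \<theta>))"

lemma weyl_sum_nonneg: "X > 0 \<Longrightarrow> weyl_sum X j \<theta> \<ge> 0"
  by (induction j arbitrary: \<theta>) (auto simp: less_imp_le capped_recip_pos intro!: sum_nonneg)

lemma power_sum2_le:
  fixes x y :: real
  assumes "x \<ge> 0" "y \<ge> 0"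
  shows "(x + y) ^ n \<le> 2 ^ n * (x ^ n + y ^ n)"
proof -
  have "(x + y) ^ n \<le> (2 * max x y) ^ n" using assms by (intro power_mono) auto
  also have "\<dots> = 2 ^ n * (max x y) ^ n" by (simp add: power_mult_distrib)
  also have "(max x y) ^ n \<le> x ^ n + y ^ n" using assms by (auto simp: max_def)
  finally show ?thesis by simp
qed

text \<open>The bookkeeping of one differencing step. It is applied with \<open>a = R ^ n\<close>,
  \<open>b = 2 ^ n\<close>, \<open>W = R ^ Suc j\<close>, with \<open>x\<close> the power of a sum
  and \<open>y\<close> the corresponding sum of powers.\<close>

lemma weyl_step_arith:
  fixes R W a b x y g C :: real
  assumes "R * x \<le> a * y" "y * W \<le> C * a * (W + g)" "R \<le> a" "0 \<le> R" "0 \<le> W" "0 \<le> g" "0 \<le> b"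
  shows "b * (a + b * x) * (R * W) \<le> b * (1 + b * C) * (a * a) * (W + g)"
proof -
  have "(a + b * x) * (R * W) = a * W * R + b * W * (R * x)" by (simp add: algebra_simps)
  also have "\<dots> \<le> a * W * a + b * W * (a * y)"
    using assms by (intro add_mono mult_left_mono) auto
  also have "\<dots> = a * a * W + b * a * (y * W)" by (simp add: algebra_simps)
  also have "\<dots> \<le> a * a * (W + g) + b * a * (C * a * (W + g))"
    using assms by (intro add_mono mult_left_mono) auto
  also have "\<dots> = (1 + b * C) * (a * a) * (W + g)" by (simp add: algebra_simps)
  finally have "b * ((a + b * x) * (R * W)) \<le> b * ((1 + b * C) * (a * a) * (W + g))"
    using assms(7) by (rule mult_left_mono)
  then show ?thesis by (simp only: mult.assoc)
qed

text \<open>Induction on the number of differencing steps. The square of the sum is bounded by sums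
  over \<open>h\<close> whose phase has degree one less; the power mean inequality moves the
  \<open>2 ^ j\<close>-th power inside the sum over \<open>h\<close>, where the induction hypothesis
  applies. Differencing shortens the range by \<open>h\<close>, hence the bound for every length
  \<open>Y \<le> X\<close>. Powers of \<open>X\<close> stand on both sides to keep the exponents
  natural numbers.\<close>

lemma weyl_inequality:
  "\<exists>C>0. \<forall>P \<beta> X Y. poly_phase (Suc j) \<beta> P \<longrightarrow> Y \<le> X \<longrightarrow> X > 0 \<longrightarrow>
     norm (\<Sum>t<Y. cis (2 * pi * P t)) ^ (2 ^ j) * real X ^ Suc j
       \<le> C * real X ^ (2 ^ j) * (real X ^ j + weyl_sum X j (fact (Suc j) * \<beta>))"
proof (induction j)
  case 0
  show ?case
  proof (intro exI[of _ 1] conjI allI impI)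
    fix P :: "nat \<Rightarrow> real" and \<beta> :: real and X Y :: nat
    assume P: "poly_phase (Suc 0) \<beta> P" and Y: "Y \<le> X" "X > 0"
    define b where "b = P 0"
    have "P t = \<beta> * real t + b" for t
    proof -
      have "P (0 + t) - P 0 = real (Suc 0) * real t * \<beta>" using P unfolding poly_phase.simps by blast
      then show ?thesis by (simp add: mult.commute b_def)
    qed
    then have "norm (\<Sum>t<Y. cis (2 * pi * P t)) = norm (\<Sum>t<Y. cis (2 * pi * (\<beta> * real t + b)))"
      by simp
    also have "\<dots> \<le> capped_recip (real X) \<beta>"
      by (rule norm_sum_cis_linear_le) (use Y in auto)
    finally have "norm (\<Sum>t<Y. cis (2 * pi * P t)) * real X \<le> (1 + capped_recip (real X) \<beta>) * real X"
      using Y by (intro mult_right_mono) auto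
    then show "norm (\<Sum>t<Y. cis (2 * pi * P t)) ^ (2 ^ 0) * real X ^ Suc 0
       \<le> 1 * real X ^ (2 ^ 0) * (real X ^ 0 + weyl_sum X 0 (fact (Suc 0) * \<beta>))"
      by (simp add: mult.commute)
  qed auto
next
  case (Suc j)
  then obtain C where C: "C > 0" and IH: "\<And>P \<beta> X Y. poly_phase (Suc j) \<beta> P \<Longrightarrow> Y \<le> X \<Longrightarrow> X > 0 \<Longrightarrow>
     norm (\<Sum>t<Y. cis (2 * pi * P t)) ^ (2 ^ j) * real X ^ Suc j
       \<le> C * real X ^ (2 ^ j) * (real X ^ j + weyl_sum X j (fact (Suc j) * \<beta>))" by blast
  define n :: nat where "n = 2 ^ j"
  define D :: real where "D = 2 ^ n * (1 + 2 ^ n * C)"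
  have n1: "n \<ge> 1" by (simp add: n_def)
  show ?case
  proof (intro exI[of _ D] conjI allI impI)
    show "D > 0" using C by (simp add: D_def add_pos_pos)
    fix P :: "nat \<Rightarrow> real" and \<beta> :: real and X Y :: nat
    assume P: "poly_phase (Suc (Suc j)) \<beta> P" and Y: "Y \<le> X" "X > 0"
    define R where "R = real X"
    define S where "S = norm (\<Sum>t<Y. cis (2 * pi * P t))"
    define V where "V h = norm (\<Sum>t<Y - h. cis (2 * pi * (P (t + h) - P t)))" for h
    define G where "G h = weyl_sum X j (fact (Suc j) * (real (Suc (Suc j)) * real h * \<beta>))" for h
    have R: "R \<ge> 1" using Y by (simp add: R_def)
    have Vb: "V h ^ n * R ^ Suc j \<le> C * R ^ n * (R ^ j + G h)" for h
      unfolding V_def n_def R_def G_def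
    proof (rule IH)
      show "poly_phase (Suc j) (real (Suc (Suc j)) * real h * \<beta>) (\<lambda>t. P (t + h) - P t)"
        using P by (subst (asm) poly_phase.simps) blast
    qed (use Y in simp_all)
    have Vnn: "V h \<ge> 0" for h by (simp add: V_def)
    have S2: "S\<^sup>2 \<le> R + 2 * (\<Sum>h=1..X. V h)"
    proof -
      have "S\<^sup>2 \<le> real Y + 2 * (\<Sum>h\<in>{1..<Y}. norm (\<Sum>t<Y - h. cis (2 * pi * P (t + h)) * cnj (cis (2 * pi * P t))))"
        unfolding S_def by (rule norm_sum_squared_le) simp
      also have "(\<Sum>h\<in>{1..<Y}. norm (\<Sum>t<Y - h. cis (2 * pi * P (t + h)) * cnj (cis (2 * pi * P t)))) = (\<Sum>h\<in>{1..<Y}. V h)"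
        unfolding V_def by (simp add: cis_cnj cis_mult right_diff_distrib)
      also have "\<dots> \<le> (\<Sum>h=1..X. V h)" using Y Vnn by (intro sum_mono2) auto
      finally show ?thesis using Y by (simp add: R_def)
    qed
    have pm: "R * (\<Sum>h=1..X. V h) ^ n \<le> R ^ n * (\<Sum>h=1..X. V h ^ n)"
      using sum_power_two_power_le[of "{1..X}" V j] Vnn by (simp add: R_def n_def)
    define \<sigma> where "\<sigma> = (\<Sum>h=1..X. V h)"
    define \<tau> where "\<tau> = (\<Sum>h=1..X. V h ^ n)"
    define g where "g = (\<Sum>h=1..X. G h)"
    have g: "g \<ge> 0" unfolding g_def G_def using Y by (intro sum_nonneg weyl_sum_nonneg)
    have \<sigma>: "\<sigma> \<ge> 0" unfolding \<sigma>_def using Vnn by (intro sum_nonneg)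
    have \<tau>: "\<tau> * R ^ Suc j \<le> C * R ^ n * (R ^ Suc j + g)"
    proof -
      have "\<tau> * R ^ Suc j = (\<Sum>h=1..X. V h ^ n * R ^ Suc j)"
        unfolding \<tau>_def by (rule sum_distrib_right)
      also have "\<dots> \<le> (\<Sum>h=1..X. C * R ^ n * (R ^ j + G h))" by (intro sum_mono Vb)
      also have "\<dots> = C * R ^ n * (\<Sum>h=1..X. R ^ j + G h)" by (rule sum_distrib_left[symmetric])
      also have "(\<Sum>h=1..X. R ^ j + G h) = R ^ Suc j + g" unfolding sum.distrib g_def by (simp add: R_def)
      finally show ?thesis .
    qed
    have S2n: "(S\<^sup>2) ^ n \<le> 2 ^ n * (R ^ n + 2 ^ n * \<sigma> ^ n)"
    proof -
      have "(S\<^sup>2) ^ n \<le> (R + 2 * \<sigma>) ^ n" unfolding \<sigma>_def by (intro power_mono S2) auto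
      also have "\<dots> \<le> 2 ^ n * (R ^ n + (2 * \<sigma>) ^ n)"
        using R \<sigma> by (intro power_sum2_le) auto
      finally show ?thesis by (simp add: power_mult_distrib)
    qed
    have "S ^ (2 ^ Suc j) * (R * R ^ Suc j) = (S\<^sup>2) ^ n * (R * R ^ Suc j)"
      by (simp add: n_def power_mult[symmetric])
    also have "\<dots> \<le> 2 ^ n * (R ^ n + 2 ^ n * \<sigma> ^ n) * (R * R ^ Suc j)"
      by (rule mult_right_mono[OF S2n]) (use R in simp)
    also have "\<dots> \<le> 2 ^ n * (1 + 2 ^ n * C) * (R ^ n * R ^ n) * (R ^ Suc j + g)"
    proof (rule weyl_step_arith)
      show "R * \<sigma> ^ n \<le> R ^ n * \<tau>" using pm by (simp add: \<sigma>_def \<tau>_def)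
      show "R \<le> R ^ n" using R n1 by (intro self_le_power) auto
    qed (use \<tau> R g in auto)
    also have "R ^ n * R ^ n = R ^ (2 ^ Suc j)" by (simp add: n_def mult_2 power_add)
    \<comment> \<open>Differencing multiplies the leading coefficient by \<open>(j + 2) h\<close>:
      the first factor completes the factorial, the second is the one in the recursion of
      \<open>weyl_sum\<close>.\<close>
    also have "g = weyl_sum X (Suc j) (fact (Suc (Suc j)) * \<beta>)"
    proof -
      have "fact (Suc j) * (real (Suc (Suc j)) * real h * \<beta>) = real h * (fact (Suc (Suc j)) * \<beta>)" for h
        unfolding fact_Suc[of "Suc j"] by (simp only: mult_ac)
      then show ?thesis unfolding weyl_sum.simps G_def g_def by (simp only:)
    qed
    finally show "norm (\<Sum>t<Y. cis (2 * pi * P t)) ^ (2 ^ Suc j) * real X ^ Suc (Suc j)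
       \<le> D * real X ^ (2 ^ Suc j) * (real X ^ Suc j + weyl_sum X (Suc j) (fact (Suc (Suc j)) * \<beta>))"
      unfolding S_def R_def D_def power_Suc[of _ "Suc j"] .
  qed
qed

text \<open>Merging the outer variable \<open>r\<close> with one variable \<open>h\<close> into the
  product \<open>s = h r\<close> counts each \<open>s\<close> at most as often as it has divisors,
  so it costs a factor \<open>T\<close>. After \<open>j\<close> mergers a single variable is
  left.\<close>

lemma sum_weyl_sum_le:
  assumes T: "\<And>n::nat. 0 < n \<Longrightarrow> n \<le> R * X ^ j \<Longrightarrow> real (card {d. d dvd n}) \<le> T"
    and "X > 0" "T \<ge> 0"
  shows "(\<Sum>r=1..R. weyl_sum X j (real r * \<theta>)) \<le> T ^ j * (\<Sum>s=1..R * X ^ j. capped_recip (real X) (real s * \<theta>))"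
  using T
proof (induction j arbitrary: R)
  case (Suc j)
  let ?f = "\<lambda>s. weyl_sum X j (real s * \<theta>)"
  have f0: "?f s \<ge> 0" for s using assms(2) by (rule weyl_sum_nonneg)
  have "(\<Sum>r=1..R. weyl_sum X (Suc j) (real r * \<theta>)) = (\<Sum>r=1..R. \<Sum>h=1..X. ?f (h * r))"
    by (simp add: mult.assoc)
  also have "\<dots> = (\<Sum>(r, h)\<in>{1..R} \<times> {1..X}. ?f (h * r))" by (rule sum.cartesian_product)
  also have "\<dots> = (\<Sum>s=1..R * X. \<Sum>x\<in>{x \<in> {1..R} \<times> {1..X}. snd x * fst x = s}. ?f (snd x * fst x))"
    by (subst sum.group) (auto simp: case_prod_beta mult.commute intro!: mult_le_mono)
  also have "\<dots> \<le> (\<Sum>s=1..R * X. T * ?f s)"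
  proof (intro sum_mono)
    fix s assume s: "s \<in> {1..R * X}"
    let ?A = "{x \<in> {1..R} \<times> {1..X}. snd x * fst x = s}"
    have "card ?A \<le> card {d. d dvd s}"
    proof (rule card_inj_on_le[of fst])
      show "inj_on fst ?A" by (auto simp: inj_on_def)
      show "finite {d. d dvd s}" using s by (intro finite_divisors_nat) auto
    qed auto
    moreover have "real (card {d. d dvd s}) \<le> T"
    proof (rule Suc.prems)
      have "s * 1 \<le> R * X * X ^ j" using s assms(2) by (intro mult_le_mono) (auto simp: Suc_le_eq)
      then show "s \<le> R * X ^ Suc j" by (simp add: mult.assoc)
    qed (use s in auto)
    ultimately have "real (card ?A) \<le> T" by linarith
    then have "real (card ?A) * ?f s \<le> T * ?f s" by (intro mult_right_mono f0)
    moreover have "(\<Sum>x\<in>?A. ?f (snd x * fst x)) = real (card ?A) * ?f s" by simp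
    ultimately show "(\<Sum>x\<in>?A. ?f (snd x * fst x)) \<le> T * ?f s" by linarith
  qed
  also have "\<dots> = T * (\<Sum>s=1..R * X. ?f s)" by (rule sum_distrib_left[symmetric])
  also have "\<dots> \<le> T * (T ^ j * (\<Sum>s=1..R * X * X ^ j. capped_recip (real X) (real s * \<theta>)))"
    using assms(3) Suc.prems by (intro mult_left_mono Suc.IH) (auto simp: mult.assoc)
  finally show ?case by (simp add: mult.assoc)
qed simp

text \<open>The multiples of \<open>c\<close> form part of the longer range and all terms are
  positive. In this way an integer factor of the leading coefficient becomes a factor of the length,
  and the rational approximation to \<alpha> itself stays applicable.\<close>

lemma sum_capped_recip_multiples_le:
  assumes "c > 0" "B > 0"
  shows "(\<Sum>s=1..S. capped_recip B (real s * (real c * \<alpha>))) \<le> (\<Sum>s=1..S * c. capped_recip B (real s * \<alpha>))"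
proof -
  have "(\<Sum>s=1..S. capped_recip B (real s * (real c * \<alpha>))) = (\<Sum>s\<in>(\<lambda>s. s * c) ` {1..S}. capped_recip B (real s * \<alpha>))"
    using assms by (subst sum.reindex) (auto simp: inj_on_def mult.assoc)
  also have "\<dots> \<le> (\<Sum>s=1..S * c. capped_recip B (real s * \<alpha>))"
    using assms by (intro sum_mono2) (auto simp: Suc_le_eq less_imp_le capped_recip_pos)
  finally show ?thesis .
qed

section \<open>A kernel detecting small fractional parts\<close>

text \<open>Among all nonnegative trigonometric polynomials of degree at most \<open>L - 2\<close> this one maximises the
  ratio of the first to the zeroth Fourier coefficient, which equals \<open>cos (\<pi> / L)\<close>; hence it yields a
  minorant for an interval of length of order \<open>1 / L\<close>.\<close>
definition fejer_kernel :: "nat \<Rightarrow> real \<Rightarrow> real" where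
  "fejer_kernel L x = (norm (\<Sum>j<L. of_real (sin (pi * real j / real L)) * cis (2 * pi * (real j * x))))\<^sup>2"

lemma fejer_kernel_nonneg: "fejer_kernel L x \<ge> 0"
  by (simp add: fejer_kernel_def)

lemma sin_pi_frac_nonneg: "j \<le> L \<Longrightarrow> sin (pi * real j / real L) \<ge> 0"
  by (cases "L = 0") (auto intro!: sin_ge_zero simp: field_simps)

text \<open>As \<open>L\<close> is even, shifting the index by \<open>L / 2\<close> turns sines into
  cosines, so the two halves of the sum add up to \<open>L / 2\<close>.\<close>

lemma sum_sin_squared:
  assumes "even L" "L > 0"
  shows "(\<Sum>j<L. (sin (pi * real j / real L))\<^sup>2) = real L / 2"
proof -
  obtain m where L: "L = 2 * m" using assms by (elim evenE)
  have m: "m > 0" using assms L by simp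
  have split: "(\<Sum>j<m + k. f j) = (\<Sum>j<m. f j) + (\<Sum>j<k. f (m + j))" for f :: "nat \<Rightarrow> real" and k
    by (induction k) (simp_all add: add.assoc)
  have "(\<Sum>j<m + m. (sin (pi * real j / real L))\<^sup>2)
      = (\<Sum>j<m. (sin (pi * real j / real L))\<^sup>2) + (\<Sum>j<m. (sin (pi * real (m + j) / real L))\<^sup>2)"
    by (rule split)
  also have "(\<Sum>j<m. (sin (pi * real (m + j) / real L))\<^sup>2) = (\<Sum>j<m. (cos (pi * real j / real L))\<^sup>2)"
  proof (intro sum.cong refl)
    fix j
    have "pi * real (m + j) / real L = pi / 2 + pi * real j / real L"
      using m by (simp add: L field_simps)
    then show "(sin (pi * real (m + j) / real L))\<^sup>2 = (cos (pi * real j / real L))\<^sup>2"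
      by (simp add: sin_add)
  qed
  also have "(\<Sum>j<m. (sin (pi * real j / real L))\<^sup>2) + (\<Sum>j<m. (cos (pi * real j / real L))\<^sup>2) = real m"
    by (simp add: sum.distrib[symmetric])
  also have "real m = real L / 2" by (simp add: L)
  also have "m + m = L" by (simp add: L)
  finally show ?thesis .
qed

text \<open>Cauchy-Schwarz. This trivial bound exceeds the mean \<open>L / 2\<close> of the kernel
  by a factor \<open>L\<close>; it is used on progressions to large moduli.\<close>

lemma fejer_kernel_le:
  assumes "even L" "L > 0"
  shows "fejer_kernel L x \<le> real L * (real L / 2)"
proof -
  have "fejer_kernel L x \<le> (\<Sum>j<L. \<bar>sin (pi * real j / real L)\<bar>)\<^sup>2"
    unfolding fejer_kernel_def by (rule power_mono[OF order_trans[OF norm_sum]]) (simp_all add: norm_mult)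
  also have "\<dots> \<le> (\<Sum>j<L. \<bar>sin (pi * real j / real L)\<bar>\<^sup>2) * real (card {..<L})"
    by (rule sum_squared_le_sum_of_squares)
  also have "\<dots> = real L * (real L / 2)" using sum_sin_squared[OF assms] by simp
  finally show ?thesis .
qed

text \<open>The numbers \<open>r h\<close> are the autocorrelations of the sine coefficients:
  nonnegative because the sines are, and at most \<open>L / 2\<close> by the inequality between
  arithmetic and geometric mean.\<close>

lemma fejer_kernel_expand:
  assumes "even L" "L > 0"
  obtains r where "\<And>h. h \<in> {1..<L} \<Longrightarrow> 0 \<le> r h \<and> r h \<le> real L / 2"
    "\<And>x. fejer_kernel L x = real L / 2 + 2 * (\<Sum>h\<in>{1..<L}. r h * cos (2 * pi * (real h * x)))"
proof -
  define a where "a j = sin (pi * real j / real L)" for j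
  define r where "r h = (\<Sum>j<L - h. a (j + h) * a j)" for h
  have a0: "a j \<ge> 0" if "j \<le> L" for j using sin_pi_frac_nonneg[OF that] by (simp add: a_def)
  have sq: "(\<Sum>j<L. (a j)\<^sup>2) = real L / 2" unfolding a_def by (rule sum_sin_squared[OF assms])
  show ?thesis
  proof
    fix h assume h: "h \<in> {1..<L}"
    have "r h \<ge> 0" unfolding r_def by (intro sum_nonneg mult_nonneg_nonneg a0) auto
    moreover have "r h \<le> real L / 2"
    proof -
      have "2 * r h \<le> (\<Sum>j<L - h. (a (j + h))\<^sup>2 + (a j)\<^sup>2)"
        unfolding r_def sum_distrib_left
      proof (intro sum_mono)
        show "2 * (a (j + h) * a j) \<le> (a (j + h))\<^sup>2 + (a j)\<^sup>2" for j
          using sum_squares_bound[of "a (j + h)" "a j"] by (simp add: mult.assoc)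
      qed
      also have "\<dots> = (\<Sum>j<L - h. (a (j + h))\<^sup>2) + (\<Sum>j<L - h. (a j)\<^sup>2)" by (rule sum.distrib)
      also have "(\<Sum>j<L - h. (a (j + h))\<^sup>2) = (\<Sum>j\<in>{h..<L}. (a j)\<^sup>2)"
        by (rule sum.reindex_bij_witness[of _ "\<lambda>j. j - h" "\<lambda>j. j + h"]) auto
      also have "\<dots> \<le> (\<Sum>j<L. (a j)\<^sup>2)" by (intro sum_mono2) auto
      also have "(\<Sum>j<L - h. (a j)\<^sup>2) \<le> (\<Sum>j<L. (a j)\<^sup>2)" by (intro sum_mono2) auto
      finally show ?thesis using sq by simp
    qed
    ultimately show "0 \<le> r h \<and> r h \<le> real L / 2" by blast
  next
    fix x
    define u where "u j = complex_of_real (a j) * cis (2 * pi * (real j * x))" for j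
    have "u (j + h) * cnj (u j) = complex_of_real (a (j + h) * a j) * cis (2 * pi * (real h * x))" for j h
    proof -
      have "u (j + h) * cnj (u j) = complex_of_real (a (j + h) * a j)
          * (cis (2 * pi * (real (j + h) * x)) * cis (- (2 * pi * (real j * x))))"
        by (simp add: u_def cis_cnj)
      also have "cis (2 * pi * (real (j + h) * x)) * cis (- (2 * pi * (real j * x))) = cis (2 * pi * (real h * x))"
        by (simp add: cis_mult algebra_simps)
      finally show ?thesis .
    qed
    then have "Re (\<Sum>h\<in>{1..<L}. \<Sum>j<L - h. u (j + h) * cnj (u j))
       = (\<Sum>h\<in>{1..<L}. r h * cos (2 * pi * (real h * x)))"
      by (simp add: r_def sum_distrib_right)
    moreover have "(\<Sum>j<L. (norm (u j))\<^sup>2) = real L / 2" using sq by (simp add: u_def norm_mult)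
    moreover have "fejer_kernel L x = (norm (\<Sum>j<L. u j))\<^sup>2"
      by (simp add: fejer_kernel_def u_def a_def)
    ultimately show "fejer_kernel L x = real L / 2 + 2 * (\<Sum>h\<in>{1..<L}. r h * cos (2 * pi * (real h * x)))"
      using norm_sum_squared_eq[of u L] by simp
  qed
qed

section \<open>Averages of the kernel over finite sets, and the minorant\<close>

lemma abs_sum_cos_le:
  "\<bar>\<Sum>t\<in>A. cos (2 * pi * (c * x t))\<bar> \<le> norm (\<Sum>t\<in>A. cis (2 * pi * (c * x t)))"
  using abs_Re_le_cmod[of "\<Sum>t\<in>A. cis (2 * pi * (c * x t))"] by simp

text \<open>The frequency 0 is left out, since it provides the main term.\<close>

definition exp_sum_total :: "nat \<Rightarrow> 'a set \<Rightarrow> ('a \<Rightarrow> real) \<Rightarrow> real" where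
  "exp_sum_total L A x = (\<Sum>h\<in>{1..<L}. norm (\<Sum>t\<in>A. cis (2 * pi * (real h * x t))))"

lemma exp_sum_total_nonneg: "exp_sum_total L A x \<ge> 0"
  unfolding exp_sum_total_def by (intro sum_nonneg) auto

text \<open>The constant Fourier coefficient \<open>L / 2\<close> gives the main term; every other
  one enters twice and is at most \<open>L / 2\<close>, whence the factor \<open>L\<close> of the
  error.\<close>

lemma sum_fejer_kernel:
  assumes "even L" "L > 0"
  shows "\<bar>(\<Sum>t\<in>A. fejer_kernel L (x t)) - real L / 2 * real (card A)\<bar> \<le> real L * exp_sum_total L A x"
proof -
  obtain r where r: "\<And>h. h \<in> {1..<L} \<Longrightarrow> 0 \<le> r h \<and> r h \<le> real L / 2"
    and eq: "\<And>x. fejer_kernel L x = real L / 2 + 2 * (\<Sum>h\<in>{1..<L}. r h * cos (2 * pi * (real h * x)))"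
    by (rule fejer_kernel_expand[OF assms that]) assumption+
  have "(\<Sum>t\<in>A. fejer_kernel L (x t))
    = real L / 2 * real (card A) + 2 * (\<Sum>t\<in>A. \<Sum>h\<in>{1..<L}. r h * cos (2 * pi * (real h * x t)))"
    unfolding eq sum.distrib sum_distrib_left[symmetric, of 2] by simp
  also have "(\<Sum>t\<in>A. \<Sum>h\<in>{1..<L}. r h * cos (2 * pi * (real h * x t)))
     = (\<Sum>h\<in>{1..<L}. r h * (\<Sum>t\<in>A. cos (2 * pi * (real h * x t))))"
    unfolding sum_distrib_left by (rule sum.swap)
  finally have "(\<Sum>t\<in>A. fejer_kernel L (x t)) - real L / 2 * real (card A)
     = 2 * (\<Sum>h\<in>{1..<L}. r h * (\<Sum>t\<in>A. cos (2 * pi * (real h * x t))))" by simp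
  also have "\<bar>\<dots>\<bar> \<le> 2 * (\<Sum>h\<in>{1..<L}. real L / 2 * norm (\<Sum>t\<in>A. cis (2 * pi * (real h * x t))))"
  proof -
    have "\<bar>\<Sum>h\<in>{1..<L}. r h * (\<Sum>t\<in>A. cos (2 * pi * (real h * x t)))\<bar>
       \<le> (\<Sum>h\<in>{1..<L}. \<bar>r h * (\<Sum>t\<in>A. cos (2 * pi * (real h * x t)))\<bar>)" by (rule sum_abs)
    also have "\<dots> \<le> (\<Sum>h\<in>{1..<L}. real L / 2 * norm (\<Sum>t\<in>A. cis (2 * pi * (real h * x t))))"
    proof (intro sum_mono)
      fix h assume "h \<in> {1..<L}"
      with r have "0 \<le> r h" "r h \<le> real L / 2" by auto
      then show "\<bar>r h * (\<Sum>t\<in>A. cos (2 * pi * (real h * x t)))\<bar>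
          \<le> real L / 2 * norm (\<Sum>t\<in>A. cis (2 * pi * (real h * x t)))"
        unfolding abs_mult by (intro mult_mono[OF _ abs_sum_cos_le]) simp_all
    qed
    finally show ?thesis unfolding abs_mult by simp
  qed
  also have "\<dots> = real L * exp_sum_total L A x"
    unfolding exp_sum_total_def sum_distrib_left[symmetric, of "real L / 2"] by simp
  finally show ?thesis .
qed

text \<open>The numbers \<open>a j = sin (j \<theta>)\<close> satisfy
  \<open>a (j + 2) + a j = 2 cos \<theta> a (j + 1)\<close>, so multiplication by
  \<open>z + 1 / z - 2 cos \<theta>\<close> leaves only boundary terms. Here \<open>w\<close> is
  \<open>1 / z\<close>.\<close>

lemma sine_poly_recurrence:
  fixes z w :: complex and \<theta> :: real
  assumes "z * w = 1"
  shows "(z + w - of_real (2 * cos \<theta>)) * (\<Sum>j<Suc n. of_real (sin (real j * \<theta>)) * z ^ j)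
     = of_real (sin \<theta>) - of_real (sin (real (Suc n) * \<theta>)) * z ^ n + of_real (sin (real n * \<theta>)) * z ^ Suc n"
proof (induction n)
  case (Suc n)
  define s where "s = (\<Sum>j<Suc n. complex_of_real (sin (real j * \<theta>)) * z ^ j)"
  define a where "a j = complex_of_real (sin (real j * \<theta>))" for j
  have rec: "a (Suc (Suc n)) + a n = of_real (2 * cos \<theta>) * a (Suc n)"
  proof -
    have e: "real (Suc (Suc n)) * \<theta> = real (Suc n) * \<theta> + \<theta>" "real n * \<theta> = real (Suc n) * \<theta> - \<theta>"
      by (simp_all add: algebra_simps)
    have "sin (real (Suc (Suc n)) * \<theta>) + sin (real n * \<theta>) = 2 * cos \<theta> * sin (real (Suc n) * \<theta>)"
      unfolding e sin_add sin_diff by (simp only: mult_ac)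
    then show ?thesis unfolding a_def by (metis of_real_add of_real_mult)
  qed
  have wz: "w * z ^ Suc n = z ^ n" using assms by (simp add: mult.assoc[symmetric] mult.commute[of w z])
  have "(z + w - of_real (2 * cos \<theta>)) * (s + a (Suc n) * z ^ Suc n)
     = (z + w - of_real (2 * cos \<theta>)) * s + a (Suc n) * z ^ Suc (Suc n) + a (Suc n) * (w * z ^ Suc n)
       - (of_real (2 * cos \<theta>) * a (Suc n)) * z ^ Suc n"
    by (simp add: algebra_simps)
  also have "\<dots> = (of_real (sin \<theta>) - a (Suc n) * z ^ n + a n * z ^ Suc n) + a (Suc n) * z ^ Suc (Suc n)
      + a (Suc n) * z ^ n - (a (Suc (Suc n)) + a n) * z ^ Suc n"
    unfolding wz rec using Suc.IH by (simp add: s_def a_def)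
  also have "\<dots> = of_real (sin \<theta>) - a (Suc (Suc n)) * z ^ Suc n + a (Suc n) * z ^ Suc (Suc n)"
    by (simp add: algebra_simps)
  finally show ?case unfolding s_def a_def by (simp only: sum.lessThan_Suc)
qed simp

text \<open>For \<open>\<theta> = pi / L\<close> the boundary terms of the recurrence reduce to
  \<open>sin \<theta> (1 + z ^ L)\<close>. Multiplied by the conjugate of the sine polynomial, the
  two summands have equal real parts, because the coefficients are symmetric under \<open>j\<close>
  to \<open>L - j\<close>. The term \<open>j = 0\<close> on the right is zero, so the product on the
  left has mean zero.\<close>

lemma fejer_kernel_mult_cos_diff:
  assumes "L > 0"
  shows "fejer_kernel L x * (cos (2 * pi * x) - cos (pi / real L))
     = sin (pi / real L) * (\<Sum>j<L. sin (pi * real j / real L) * cos (2 * pi * (real j * x)))"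
proof -
  define \<theta> where "\<theta> = pi / real L"
  define z where "z = cis (2 * pi * x)"
  define a where "a j = sin (pi * real j / real L)" for j
  define A where "A = (\<Sum>j<L. complex_of_real (a j) * z ^ j)"
  define c where "c = (\<Sum>j<L. a j * cos (2 * pi * (real j * x)))"
  have a\<theta>: "a j = sin (real j * \<theta>)" for j by (simp add: a_def \<theta>_def mult.commute)
  have zp: "z ^ j = cis (2 * pi * (real j * x))" for j by (simp add: z_def Complex.DeMoivre mult_ac)
  have zc: "z * cnj z = 1" by (simp add: z_def cis_cnj cis_mult)
  obtain n where n: "L = Suc n" using assms by (cases L) auto
  have aL: "a L = 0" "a 0 = 0" using assms by (simp_all add: a_def)
  have a_refl: "a (L - j) = a j" if "j \<le> L" for j
  proof -
    have "pi * real (L - j) / real L = pi - pi * real j / real L"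
      using assms that by (simp add: of_nat_diff field_simps)
    then show ?thesis by (simp add: a_def sin_diff)
  qed
  have an: "a n = sin \<theta>" using a_refl[of 1] n a\<theta>[of 1] by simp
  have rec: "(z + cnj z - of_real (2 * cos \<theta>)) * A = of_real (sin \<theta>) * (1 + z ^ L)"
    using sine_poly_recurrence[OF zc, of \<theta> n] an aL(1)
    unfolding A_def n a\<theta> by (simp add: algebra_simps)
  have F: "complex_of_real (fejer_kernel L x) = A * cnj A"
    unfolding fejer_kernel_def A_def a_def zp by (rule complex_norm_square)
  have "z + cnj z = complex_of_real (2 * cos (2 * pi * x))"
    by (simp add: complex_add_cnj z_def)
  then have "complex_of_real (2 * (cos (2 * pi * x) - cos \<theta>) * fejer_kernel L x)
     = (z + cnj z - of_real (2 * cos \<theta>)) * A * cnj A"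
    unfolding of_real_mult F by (simp add: algebra_simps)
  also have "\<dots> = of_real (sin \<theta>) * ((1 + z ^ L) * cnj A)" unfolding rec by (simp only: mult.assoc)
  finally have "2 * (cos (2 * pi * x) - cos \<theta>) * fejer_kernel L x = Re (of_real (sin \<theta>) * ((1 + z ^ L) * cnj A))"
    by (metis Re_complex_of_real)
  also have "\<dots> = sin \<theta> * (Re (cnj A) + Re (z ^ L * cnj A))" by (simp add: distrib_right)
  also have "Re (cnj A) = c" by (simp add: A_def c_def zp)
  also have "Re (z ^ L * cnj A) = c"
  proof -
    have "z ^ L * cnj A = (\<Sum>j<L. of_real (a j) * cis (2 * pi * ((real L - real j) * x)))"
      unfolding A_def cnj_sum sum_distrib_left
    proof (intro sum.cong refl)
      fix j
      show "z ^ L * cnj (complex_of_real (a j) * z ^ j) = of_real (a j) * cis (2 * pi * ((real L - real j) * x))"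
        unfolding zp by (simp add: cis_cnj cis_mult mult.left_commute[of "cis _"] algebra_simps)
    qed
    then have "Re (z ^ L * cnj A) = (\<Sum>j<L. a j * cos (2 * pi * ((real L - real j) * x)))" by simp
    also have "\<dots> = (\<Sum>j\<in>{1..<L}. a j * cos (2 * pi * ((real L - real j) * x)))"
      using aL by (intro sum.mono_neutral_right) (auto simp: Suc_le_eq)
    also have "\<dots> = (\<Sum>j\<in>{1..<L}. a j * cos (2 * pi * (real j * x)))"
      by (rule sum.reindex_bij_witness[of _ "\<lambda>j. L - j" "\<lambda>j. L - j"]) (auto simp: a_refl of_nat_diff)
    also have "\<dots> = c" unfolding c_def
      using aL by (intro sum.mono_neutral_left) (auto simp: Suc_le_eq)
    finally show ?thesis .
  qed
  finally have "fejer_kernel L x * (cos (2 * pi * x) - cos \<theta>) = sin \<theta> * c" by algebra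
  then show ?thesis unfolding c_def a_def \<theta>_def .
qed

lemma cos_2pi_le:
  assumes "L \<ge> 2" "dist_nearest_int x \<ge> 1 / real L"
  shows "cos (2 * pi * x) \<le> cos (2 * pi / real L)"
proof -
  define y where "y = x - of_int (round x)"
  have y: "dist_nearest_int x = \<bar>y\<bar>" by (simp add: y_def dist_nearest_int_def)
  have "cis (2 * pi * x) = cis (2 * pi * y)"
    using cis_2pi_add_int[of y "round x"] by (simp add: y_def)
  then have "cos (2 * pi * x) = cos (2 * pi * y)" by (metis cis.sel(1))
  also have "\<dots> = cos (2 * pi * \<bar>y\<bar>)" by (cases "y \<ge> 0") auto
  also have "\<dots> \<le> cos (2 * pi * (1 / real L))"
  proof (rule cos_monotone_0_pi_le)
    show "2 * pi * (1 / real L) \<le> 2 * pi * \<bar>y\<bar>" using assms(2) y by (intro mult_left_mono) auto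
    have "2 * pi * \<bar>y\<bar> \<le> 2 * pi * (1 / 2)"
      using dist_nearest_int_le_half[of x] y by (intro mult_left_mono) auto
    then show "2 * pi * \<bar>y\<bar> \<le> pi" by simp
  qed auto
  finally show ?thesis by simp
qed

text \<open>The trigonometric polynomial \<open>F(x) (cos 2\<pi>x - cos (2\<pi>/L))\<close>, with \<open>F\<close> the kernel above, is
  positive only where \<open>\<parallel>x\<parallel> < 1 / L\<close>, but has mean at least half of that of \<open>F(x) (1 - cos (2\<pi>/L))\<close>.\<close>
lemma sum_fejer_kernel_exceptional_ge:
  assumes L: "even L" "L > 0" and A: "finite A" "B \<subseteq> A"
    and far: "\<And>t. t \<in> A - B \<Longrightarrow> dist_nearest_int (x t) \<ge> 1 / real L"
  shows "real L / 2 * (real (card A) - 3 * exp_sum_total L A x) \<le> 2 * (\<Sum>t\<in>B. fejer_kernel L (x t))"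
proof -
  define \<theta> where "\<theta> = pi / real L"
  define F where "F = fejer_kernel L"
  define E where "E = exp_sum_total L A x"
  define lam where "lam = 1 - cos (2 * \<theta>)"
  have L2: "L \<ge> 2" using L by (auto elim!: evenE)
  have s: "sin \<theta> \<ge> 2 / real L" using sin_pi_ge[of "1 / real L"] L2 by (simp add: \<theta>_def field_simps)
  then have s0: "sin \<theta> > 0" using L(2) by (smt (verit) divide_pos_pos of_nat_0_less_iff)
  have lam: "lam = 2 * (sin \<theta>)\<^sup>2" by (simp add: lam_def cos_double_sin)
  then have lam0: "lam > 0" using s0 by simp
  \<comment> \<open>By this bound the error \<open>sin \<theta> * E\<close> is at most
    \<open>lam * L / 4 * E\<close>; together with the error \<open>2 * E\<close> of the main term it
    makes up the \<open>3 * E\<close> of the claim.\<close>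
  have Ls: "sin \<theta> \<le> lam * (real L / 2) / 2"
  proof -
    have "2 * sin \<theta> \<le> (real L * sin \<theta>) * sin \<theta>"
      using s s0 L(2) by (intro mult_right_mono) (auto simp: field_simps)
    then show ?thesis unfolding lam by (simp add: power2_eq_square mult_ac)
  qed
  \<comment> \<open>As \<open>lam\<close> is twice \<open>1 - cos^2 \<theta>\<close>, this amounts
    to \<open>cos \<theta> \<ge> cos^2 \<theta>\<close>. It is the source of the ratio one half
    between the means of minorant and majorant.\<close>
  have cos: "cos \<theta> - cos (2 * \<theta>) \<ge> lam / 2"
  proof -
    have "\<theta> \<le> pi / 2" unfolding \<theta>_def using L2 by (intro divide_left_mono) auto
    then have "cos \<theta> \<ge> 0" by (intro cos_ge_zero) (auto simp: \<theta>_def intro: order_trans[of _ 0])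
    moreover have "cos \<theta> \<le> 1" by simp
    ultimately have "cos \<theta> * cos \<theta> \<le> cos \<theta> * 1" by (intro mult_left_mono)
    then show ?thesis by (simp add: lam_def cos_double_cos power2_eq_square)
  qed
  have E0: "E \<ge> 0" unfolding E_def by (rule exp_sum_total_nonneg)
  have F0: "F y \<ge> 0" for y unfolding F_def by (rule fejer_kernel_nonneg)
  have main: "(\<Sum>t\<in>A. F (x t)) \<ge> real L / 2 * (real (card A) - 2 * E)"
    using sum_fejer_kernel[OF L, of x A] unfolding E_def F_def by (simp add: algebra_simps)
  have err: "(\<Sum>t\<in>A. F (x t) * (cos (2 * pi * x t) - cos \<theta>)) \<ge> - (sin \<theta> * E)"
  proof -
    have "(\<Sum>t\<in>A. F (x t) * (cos (2 * pi * x t) - cos \<theta>))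
        = sin \<theta> * (\<Sum>t\<in>A. \<Sum>j<L. sin (pi * real j / real L) * cos (2 * pi * (real j * x t)))"
      unfolding F_def \<theta>_def fejer_kernel_mult_cos_diff[OF L(2)] by (rule sum_distrib_left[symmetric])
    also have "(\<Sum>t\<in>A. \<Sum>j<L. sin (pi * real j / real L) * cos (2 * pi * (real j * x t)))
        = (\<Sum>j<L. sin (pi * real j / real L) * (\<Sum>t\<in>A. cos (2 * pi * (real j * x t))))"
      unfolding sum_distrib_left by (rule sum.swap)
    also have "\<dots> = (\<Sum>j\<in>{1..<L}. sin (pi * real j / real L) * (\<Sum>t\<in>A. cos (2 * pi * (real j * x t))))"
      by (intro sum.mono_neutral_right) (auto simp: Suc_le_eq)
    finally have eq: "(\<Sum>t\<in>A. F (x t) * (cos (2 * pi * x t) - cos \<theta>))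
       = sin \<theta> * (\<Sum>j\<in>{1..<L}. sin (pi * real j / real L) * (\<Sum>t\<in>A. cos (2 * pi * (real j * x t))))" .
    have "(\<Sum>j\<in>{1..<L}. sin (pi * real j / real L) * (\<Sum>t\<in>A. cos (2 * pi * (real j * x t))))
       \<ge> (\<Sum>j\<in>{1..<L}. - norm (\<Sum>t\<in>A. cis (2 * pi * (real j * x t))))"
    proof (intro sum_mono)
      fix j
      have "\<bar>sin (pi * real j / real L)\<bar> * \<bar>\<Sum>t\<in>A. cos (2 * pi * (real j * x t))\<bar>
         \<le> 1 * norm (\<Sum>t\<in>A. cis (2 * pi * (real j * x t)))"
        by (intro mult_mono abs_sum_cos_le) auto
      then show "- norm (\<Sum>t\<in>A. cis (2 * pi * (real j * x t)))
         \<le> sin (pi * real j / real L) * (\<Sum>t\<in>A. cos (2 * pi * (real j * x t)))"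
        unfolding abs_mult[symmetric] by linarith
    qed
    then have "- E \<le> (\<Sum>j\<in>{1..<L}. sin (pi * real j / real L) * (\<Sum>t\<in>A. cos (2 * pi * (real j * x t))))"
      by (simp add: E_def exp_sum_total_def sum_negf)
    from mult_left_mono[OF this, of "sin \<theta>"] show ?thesis unfolding eq using s0 by simp
  qed
  \<comment> \<open>The first part has mean zero and contributes only an error; the second is a
    positive multiple of the kernel and carries the main term.\<close>
  have split: "(\<Sum>t\<in>A. F (x t) * (cos (2 * pi * x t) - cos (2 * \<theta>)))
     = (\<Sum>t\<in>A. F (x t) * (cos (2 * pi * x t) - cos \<theta>)) + (cos \<theta> - cos (2 * \<theta>)) * (\<Sum>t\<in>A. F (x t))"
    unfolding sum_distrib_left sum.distrib[symmetric] by (intro sum.cong refl) (simp add: algebra_simps)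
  \<comment> \<open>Outside \<open>B\<close> the points are far from the integers and the cosine
    factor is at most 0; on \<open>B\<close> it is at most \<open>lam\<close>.\<close>
  have "(\<Sum>t\<in>A. F (x t) * (cos (2 * pi * x t) - cos (2 * \<theta>))) \<le> lam * (\<Sum>t\<in>B. F (x t))"
  proof -
    have "(\<Sum>t\<in>A. F (x t) * (cos (2 * pi * x t) - cos (2 * \<theta>)))
       = (\<Sum>t\<in>A - B. F (x t) * (cos (2 * pi * x t) - cos (2 * \<theta>))) + (\<Sum>t\<in>B. F (x t) * (cos (2 * pi * x t) - cos (2 * \<theta>)))"
      by (rule sum.subset_diff[OF A(2,1)])
    also have "(\<Sum>t\<in>A - B. F (x t) * (cos (2 * pi * x t) - cos (2 * \<theta>))) \<le> 0"
      using cos_2pi_le[OF L2 far] by (intro sum_nonpos mult_nonneg_nonpos F0) (auto simp: \<theta>_def)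
    also have "(\<Sum>t\<in>B. F (x t) * (cos (2 * pi * x t) - cos (2 * \<theta>))) \<le> (\<Sum>t\<in>B. F (x t) * lam)"
      unfolding lam_def by (intro sum_mono mult_left_mono F0) auto
    finally show ?thesis by (simp add: sum_distrib_left mult.commute)
  qed
  moreover have "(cos \<theta> - cos (2 * \<theta>)) * (\<Sum>t\<in>A. F (x t)) \<ge> lam / 2 * (real L / 2 * (real (card A) - 2 * E))"
  proof -
    have "lam / 2 * (real L / 2 * (real (card A) - 2 * E)) \<le> lam / 2 * (\<Sum>t\<in>A. F (x t))"
      using lam0 main by (intro mult_left_mono) auto
    also have "\<dots> \<le> (cos \<theta> - cos (2 * \<theta>)) * (\<Sum>t\<in>A. F (x t))"
      using cos F0 by (intro mult_right_mono sum_nonneg) auto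
    finally show ?thesis .
  qed
  moreover have "sin \<theta> * E \<le> lam * (real L / 2) / 2 * E" using Ls E0 by (intro mult_right_mono)
  ultimately have "lam / 2 * (real L / 2 * (real (card A) - 2 * E)) - lam * (real L / 2) / 2 * E \<le> lam * (\<Sum>t\<in>B. F (x t))"
    using split err by linarith
  moreover have "lam / 2 * (real L / 2 * (real (card A) - 2 * E)) - lam * (real L / 2) / 2 * E
     = lam * (real L / 2 * (real (card A) - 3 * E) / 2)" by (simp add: algebra_simps)
  ultimately have "real L / 2 * (real (card A) - 3 * E) / 2 \<le> (\<Sum>t\<in>B. F (x t))"
    using lam0 by (metis mult_le_cancel_left_pos)
  then show ?thesis unfolding E_def F_def by simp
qed

section \<open>Exponential sums along progressions\<close>

text \<open>Every product of variables that gets merged is at most \<open>L X ^ j\<close>, with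
  \<open>L \<le> q ^ 2\<close> and \<open>X \<le> 2 q ^ 2\<close>; this explains the range of
  \<open>m\<close>. Divisor counts and logarithm together cost only an arbitrarily small power of
  \<open>q\<close>.\<close>

lemma divisor_log_factor:
  fixes \<eta> :: real
  assumes "\<eta> > 0"
  obtains C where "C > 0" "\<And>q. q \<ge> 1 \<Longrightarrow> \<exists>T\<ge>1. (\<forall>m::nat. 0 < m \<longrightarrow> m \<le> 2 ^ j * q ^ (2 * Suc j) \<longrightarrow> real (card {d. d dvd m}) \<le> T)
      \<and> T ^ j * (1 + ln (real q)) \<le> C * real q powr \<eta>"
proof -
  \<comment> \<open>Small enough for \<open>T ^ j\<close> to cost at most half of the exponent
    \<eta>; the other half absorbs the logarithm.\<close>
  define \<eta>' where "\<eta>' = \<eta> / (4 * real (Suc j) ^ 2)"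
  have \<eta>': "\<eta>' > 0" using assms by (simp add: \<eta>'_def)
  obtain Cd where Cd: "Cd \<ge> 1" and div: "\<And>n::nat. n > 0 \<Longrightarrow> real (card {d. d dvd n}) \<le> Cd * real n powr \<eta>'"
    using card_divisors_bound[OF \<eta>'] by blast
  define B where "B = Cd * (2 ^ j) powr \<eta>'"
  have "1 * 1 \<le> B" unfolding B_def using Cd \<eta>' by (intro mult_mono ge_one_powr_ge_zero) auto
  then have B: "B \<ge> 1" by simp
  define C where "C = B ^ j * (1 + 2 / \<eta>)"
  show ?thesis
  proof
    show "C > 0" unfolding C_def using B assms by (intro mult_pos_pos add_pos_pos) auto
    fix q :: nat assume q: "q \<ge> 1"
    define T where "T = B * (real q ^ (2 * Suc j)) powr \<eta>'"
    have qp: "(real q ^ (2 * Suc j)) powr \<eta>' = real q powr (2 * real (Suc j) * \<eta>')"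
    proof -
      have "real q ^ (2 * Suc j) = real q powr real (2 * Suc j)"
        using q by (intro powr_realpow[symmetric]) auto
      then show ?thesis by (simp only: powr_powr of_nat_mult of_nat_numeral)
    qed
    have "1 * 1 \<le> T" unfolding T_def qp using B q \<eta>' by (intro mult_mono ge_one_powr_ge_zero) auto
    then have T: "T \<ge> 1" by simp
    show "\<exists>T\<ge>1. (\<forall>m::nat. 0 < m \<longrightarrow> m \<le> 2 ^ j * q ^ (2 * Suc j) \<longrightarrow> real (card {d. d dvd m}) \<le> T)
      \<and> T ^ j * (1 + ln (real q)) \<le> C * real q powr \<eta>"
    proof (intro exI[of _ T] conjI allI impI T)
      fix m :: nat assume m: "0 < m" "m \<le> 2 ^ j * q ^ (2 * Suc j)"
      have "real m \<le> real (2 ^ j * q ^ (2 * Suc j))" using m(2) by (rule of_nat_mono)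
      then have le: "real m \<le> 2 ^ j * real q ^ (2 * Suc j)" by simp
      have "real (card {d. d dvd m}) \<le> Cd * real m powr \<eta>'" by (rule div[OF m(1)])
      also have "\<dots> \<le> Cd * (2 ^ j * real q ^ (2 * Suc j)) powr \<eta>'"
        using Cd \<eta>' le by (intro mult_left_mono powr_mono2) auto
      also have "\<dots> = T" unfolding T_def B_def powr_mult by (simp only: mult.assoc)
      finally show "real (card {d. d dvd m}) \<le> T" .
    next
      have "T ^ j = B ^ j * real q powr (2 * real (Suc j) * \<eta>' * real j)"
        unfolding T_def qp power_mult_distrib using q by (simp add: powr_power mult_ac)
      also have "\<dots> \<le> B ^ j * real q powr (\<eta> / 2)"
      proof (intro mult_left_mono powr_mono)
        have "2 * real (Suc j) * \<eta>' * real j \<le> 2 * real (Suc j) * \<eta>' * real (Suc j)"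
          using \<eta>' by (intro mult_left_mono) auto
        also have "\<dots> = \<eta> / 2" unfolding \<eta>'_def by (simp add: power2_eq_square del: of_nat_Suc)
        finally show "2 * real (Suc j) * \<eta>' * real j \<le> \<eta> / 2" .
      qed (use q B in auto)
      finally have 1: "T ^ j \<le> B ^ j * real q powr (\<eta> / 2)" .
      have "ln (real q) \<le> real q powr (\<eta> / 2) / (\<eta> / 2)"
        using q assms by (intro ln_powr_bound) auto
      moreover have "1 \<le> real q powr (\<eta> / 2)" using q assms by (intro ge_one_powr_ge_zero) auto
      ultimately have 2: "1 + ln (real q) \<le> (1 + 2 / \<eta>) * real q powr (\<eta> / 2)"
        by (simp add: field_simps)
      have "T ^ j * (1 + ln (real q)) \<le> (B ^ j * real q powr (\<eta> / 2)) * ((1 + 2 / \<eta>) * real q powr (\<eta> / 2))"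
        using 1 2 B q by (intro mult_mono) auto
      also have "\<dots> = C * (real q powr (\<eta> / 2) * real q powr (\<eta> / 2))" by (simp add: C_def mult_ac)
      also have "real q powr (\<eta> / 2) * real q powr (\<eta> / 2) = real q powr \<eta>"
        by (simp add: powr_add[symmetric])
      finally show "T ^ j * (1 + ln (real q)) \<le> C * real q powr \<eta>" .
    qed
  qed
qed

text \<open>On a progression of step \<open>4 D\<close> the leading coefficient gains the factor
  \<open>(4 D) ^ Suc j\<close>, which lengthens the sum of reciprocals to \<open>S\<close>. But
  \<open>S X\<close> contains \<open>X\<close> and \<open>D\<close> only through
  \<open>(X D) ^ Suc j\<close>, and \<open>X D \<le> 2 q ^ 2\<close>, so the bound is the same for
  all \<open>D \<le> q\<close>.\<close>

lemma sum_weyl_sum_progression_le: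
  fixes a :: int and q L X D j :: nat and \<alpha> :: real
  assumes "coprime a (int q)" "\<bar>\<alpha> - of_int a / real q\<bar> \<le> 1 / real q ^ 2" "q \<ge> 1"
    and L: "1 \<le> L" "L \<le> q ^ 2" and D: "1 \<le> D" "D \<le> q" and X: "X > 0" "X * D \<le> 2 * q ^ 2"
    and T: "T \<ge> 1" "\<And>m::nat. 0 < m \<Longrightarrow> m \<le> 2 ^ j * q ^ (2 * Suc j) \<Longrightarrow> real (card {d. d dvd m}) \<le> T"
  shows "(\<Sum>h=1..L. real X ^ j + weyl_sum X j (real h * (real (fact (Suc j) * (4 * D) ^ Suc j) * \<alpha>)))
    \<le> 25 * (fact (Suc j) * 8 ^ Suc j) * (T ^ j * (1 + ln (real q))) * (real L * (real q ^ 2) ^ j * real q)"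
proof -
  define c :: nat where "c = fact (Suc j) * (4 * D) ^ Suc j"
  define S where "S = L * X ^ j * c"
  define lam where "lam = 1 + ln (real q)"
  define K :: real where "K = fact (Suc j) * 8 ^ Suc j"
  define M where "M = real q ^ 2"
  define Z where "Z = real L * M ^ j * real q"
  have lam: "lam \<ge> 1" using assms(3) by (simp add: lam_def)
  have c: "c > 0" using D by (simp add: c_def)
  have K: "K \<ge> fact (Suc j) * 4 ^ Suc j * 2 ^ j" "K \<ge> 2 ^ j" "K \<ge> 1"
  proof -
    have f: "fact (Suc j) \<ge> (1::real)" by (rule fact_ge_1)
    have e: "(8::real) ^ Suc j = 4 ^ Suc j * 2 ^ Suc j" by (simp add: power_mult_distrib[symmetric])
    have "fact (Suc j) * 4 ^ Suc j * (2::real) ^ j \<le> fact (Suc j) * 4 ^ Suc j * 2 ^ Suc j"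
      by (intro mult_left_mono power_increasing) auto
    then show 1: "K \<ge> fact (Suc j) * 4 ^ Suc j * 2 ^ j" unfolding K_def e by (simp only: mult.assoc)
    have "1 * 1 * (2::real) ^ j \<le> fact (Suc j) * 4 ^ Suc j * 2 ^ j"
      using f by (intro mult_mono one_le_power) auto
    then show 2: "K \<ge> 2 ^ j" using 1 by linarith
    then show "K \<ge> 1" using one_le_power[of "2::real" j] by linarith
  qed
  have q: "real q \<ge> 1" using assms(3) by simp
  have M1: "M \<ge> 1" unfolding M_def using q by (rule one_le_power)
  have XD: "real X * real D \<le> 2 * M"
  proof -
    have "real (X * D) \<le> real (2 * q ^ 2)" using X(2) by (rule of_nat_mono)
    then show ?thesis by (simp add: M_def)
  qed
  have X2: "real X \<le> 2 * M"
    using mult_left_mono[of 1 "real D" "real X"] D(1) XD by simp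
  have LXj: "L * X ^ j \<le> 2 ^ j * q ^ (2 * Suc j)"
  proof -
    have "X \<le> X * D" using D(1) by simp
    then have "X \<le> 2 * q ^ 2" using X(2) by linarith
    then have "L * X ^ j \<le> q ^ 2 * (2 * q ^ 2) ^ j" using L(2) by (intro mult_le_mono power_mono) auto
    also have "\<dots> = 2 ^ j * (q ^ 2) ^ Suc j" by (simp add: power_mult_distrib mult_ac)
    also have "\<dots> = 2 ^ j * q ^ (2 * Suc j)" by (simp only: power_mult)
    finally show ?thesis .
  qed
  have Z0: "Z \<ge> 0" unfolding Z_def M_def by simp
  have "(\<Sum>h=1..L. weyl_sum X j (real h * (real c * \<alpha>)))
     \<le> T ^ j * (\<Sum>s=1..L * X ^ j. capped_recip (real X) (real s * (real c * \<alpha>)))"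
    using T LXj X by (intro sum_weyl_sum_le) auto
  also have "\<dots> \<le> T ^ j * (\<Sum>s=1..S. capped_recip (real X) (real s * \<alpha>))"
    unfolding S_def using T X c by (intro mult_left_mono sum_capped_recip_multiples_le) auto
  also have "\<dots> \<le> T ^ j * (8 * lam * (real S * real X / real q + real S + real q))"
    unfolding lam_def using assms(1-3) T X by (intro mult_left_mono sum_capped_recip_le) auto
  also have "\<dots> \<le> T ^ j * (8 * lam * (K * Z + K * Z + K * Z))"
  proof (intro mult_left_mono add_mono)
    have S: "real S = fact (Suc j) * 4 ^ Suc j * real L * ((real X * real D) ^ j * real D)"
      unfolding S_def c_def of_nat_mult of_nat_power of_nat_fact of_nat_numeral power_mult_distrib power_Suc[of "real D"]
      by (simp only: mult_ac)
    have "real S * real X / real q = fact (Suc j) * 4 ^ Suc j * real L * (real X * real D) ^ Suc j / real q"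
      unfolding S by (simp add: mult_ac)
    also have "\<dots> \<le> fact (Suc j) * 4 ^ Suc j * real L * (2 * M) ^ Suc j / real q"
      using XD by (intro divide_right_mono mult_left_mono power_mono) auto
    also have "\<dots> = K * (real L * (M ^ Suc j / real q))"
    proof -
      have "(8::real) ^ Suc j = 4 ^ Suc j * 2 ^ Suc j" by (simp add: power_mult_distrib[symmetric])
      then show ?thesis unfolding K_def power_mult_distrib by (simp add: mult_ac)
    qed
    also have "M ^ Suc j / real q = M ^ j * real q" using q by (simp add: M_def power2_eq_square)
    finally show "real S * real X / real q \<le> K * Z" by (simp add: Z_def mult_ac)
    have "real S \<le> fact (Suc j) * 4 ^ Suc j * real L * ((2 * M) ^ j * real q)"
    proof -
      have "(real X * real D) ^ j \<le> (2 * M) ^ j" using XD by (intro power_mono) auto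
      then have "(real X * real D) ^ j * real D \<le> (2 * M) ^ j * real q"
        by (rule mult_mono) (use D M1 in auto)
      then show ?thesis unfolding S by (rule mult_left_mono) simp
    qed
    also have "\<dots> = (fact (Suc j) * 4 ^ Suc j * 2 ^ j) * Z" by (simp add: Z_def power_mult_distrib mult_ac)
    also have "\<dots> \<le> K * Z" using K Z0 by (intro mult_right_mono)
    finally show "real S \<le> K * Z" .
    have "1 * 1 * real q \<le> Z"
      unfolding Z_def using L(1) M1 q by (intro mult_mono one_le_power) auto
    also have "1 * Z \<le> K * Z" using K Z0 by (intro mult_right_mono)
    finally show "real q \<le> K * Z" by simp
  qed (use T lam in auto)
  finally have 1: "(\<Sum>h=1..L. weyl_sum X j (real h * (real c * \<alpha>))) \<le> 24 * (T ^ j * lam * (K * Z))"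
    by (simp add: mult_ac)
  have "real L * real X ^ j \<le> real L * (2 * M) ^ j"
    using X2 by (intro mult_left_mono power_mono) auto
  also have "\<dots> = 2 ^ j * (real L * M ^ j * 1)" by (simp add: power_mult_distrib)
  also have "\<dots> \<le> 2 ^ j * Z" unfolding Z_def using q M1 by (intro mult_left_mono) auto
  also have "\<dots> \<le> K * Z" using K Z0 by (intro mult_right_mono)
  also have "\<dots> = 1 * 1 * (K * Z)" by simp
  also have "\<dots> \<le> T ^ j * lam * (K * Z)"
    using T lam K Z0 by (intro mult_mono one_le_power) auto
  finally have 2: "real L * real X ^ j \<le> T ^ j * lam * (K * Z)" .
  have "(\<Sum>h=1..L. real X ^ j + weyl_sum X j (real h * (real c * \<alpha>)))
     = real L * real X ^ j + (\<Sum>h=1..L. weyl_sum X j (real h * (real c * \<alpha>)))"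
    by (simp add: sum.distrib)
  \<comment> \<open>Three terms with the factor 8 make 24; the term \<open>L X ^ j\<close> adds one
    more.\<close>
  also have "\<dots> \<le> 25 * (T ^ j * lam * (K * Z))" using 1 2 by linarith
  finally show ?thesis unfolding c_def K_def lam_def Z_def M_def by (simp only: mult_ac)
qed

text \<open>Weyl's inequality is applied to each frequency \<open>h\<close>, and the power mean
  inequality moves the \<open>2 ^ j\<close>-th power inside the sum over \<open>h\<close>. Thus
  \<open>h\<close> becomes one more variable of the sum of reciprocals, and the saving over the
  trivial bound \<open>L q ^ 2\<close> is \<open>q\<close> inside the \<open>2 ^ j\<close>-th power,
  uniformly in \<open>d\<close>.\<close>

lemma exp_sum_total_poly_le:
  fixes f :: "real poly" and \<eta> :: real
  assumes deg: "degree f = Suc j" and \<eta>: "\<eta> > 0"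
  obtains C where "C > 0" "\<And>a q L d Y c. coprime a (int q) \<Longrightarrow> \<bar>lead_coeff f - of_int a / real q\<bar> \<le> 1 / real q ^ 2 \<Longrightarrow>
     q \<ge> 1 \<Longrightarrow> 1 \<le> L \<Longrightarrow> L \<le> q ^ 2 \<Longrightarrow> 1 \<le> d \<Longrightarrow> d ^ 2 \<le> q \<Longrightarrow> Y * d ^ 2 \<le> 2 * q ^ 2 \<Longrightarrow>
     exp_sum_total L {..<Y} (\<lambda>t. poly f (c + real (4 * d ^ 2) * real t)) ^ (2 ^ j) * real q
       \<le> C * real q powr \<eta> * (real L * real q ^ 2) ^ (2 ^ j)"
proof -
  obtain C1 where C1: "C1 > 0" and weyl: "\<And>P \<beta> X Y. poly_phase (Suc j) \<beta> P \<Longrightarrow> Y \<le> X \<Longrightarrow> X > 0 \<Longrightarrow>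
     norm (\<Sum>t<Y. cis (2 * pi * P t)) ^ (2 ^ j) * real X ^ Suc j
       \<le> C1 * real X ^ (2 ^ j) * (real X ^ j + weyl_sum X j (fact (Suc j) * \<beta>))"
    using weyl_inequality[of j] by blast
  obtain C2 where C2: "C2 > 0" and dlog: "\<And>q. q \<ge> 1 \<Longrightarrow> \<exists>T\<ge>1. (\<forall>m::nat. 0 < m \<longrightarrow> m \<le> 2 ^ j * q ^ (2 * Suc j) \<longrightarrow> real (card {d. d dvd m}) \<le> T)
      \<and> T ^ j * (1 + ln (real q)) \<le> C2 * real q powr \<eta>"
    by (rule divisor_log_factor[OF \<eta> that, of j]) assumption+
  define n :: nat where "n = 2 ^ j"
  define K :: real where "K = 25 * (fact (Suc j) * 8 ^ Suc j)"
  define C where "C = C1 * 2 ^ n * K * C2"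
  have K: "K > 0" by (simp add: K_def)
  have n: "Suc j \<le> n" unfolding n_def by (rule Suc_leI[OF less_exp])
  show ?thesis
  proof
    show "C > 0" unfolding C_def using C1 C2 K by simp
    fix a :: int and q L d Y :: nat and c :: real
    assume aq: "coprime a (int q)" "\<bar>lead_coeff f - of_int a / real q\<bar> \<le> 1 / real q ^ 2" and q: "q \<ge> 1"
      and L: "1 \<le> L" "L \<le> q ^ 2" and d: "1 \<le> d" "d ^ 2 \<le> q" and Y: "Y * d ^ 2 \<le> 2 * q ^ 2"
    define D where "D = d ^ 2"
    define M where "M = real q ^ 2"
    \<comment> \<open>The largest length allowed for \<open>Y\<close>; since
      \<open>D \<le> q\<close>, the product \<open>X D\<close> lies between \<open>q ^ 2\<close> and
      \<open>2 q ^ 2\<close>.\<close>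
    define X where "X = 2 * q ^ 2 div D"
    define \<alpha> where "\<alpha> = lead_coeff f"
    define S where "S h = norm (\<Sum>t<Y. cis (2 * pi * (real h * poly f (c + real (4 * D) * real t))))" for h :: nat
    define E where "E = exp_sum_total L {..<Y} (\<lambda>t. poly f (c + real (4 * D) * real t))"
    define W where "W h = real X ^ j + weyl_sum X j (real h * (real (fact (Suc j) * (4 * D) ^ Suc j) * \<alpha>))" for h
    obtain T where T: "T \<ge> 1" "\<And>m::nat. 0 < m \<Longrightarrow> m \<le> 2 ^ j * q ^ (2 * Suc j) \<Longrightarrow> real (card {d. d dvd m}) \<le> T"
      and Tl: "T ^ j * (1 + ln (real q)) \<le> C2 * real q powr \<eta>" using dlog[OF q] by blast
    have D: "1 \<le> D" "D \<le> q" using d by (auto simp: D_def Suc_le_eq)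
    have qq: "q \<le> q ^ 2" using q by (simp add: power2_eq_square)
    have YX: "Y \<le> X" unfolding X_def
      by (subst less_eq_div_iff_mult_less_eq) (use Y d in \<open>auto simp: D_def\<close>)
    have XD: "X * D \<le> 2 * q ^ 2" unfolding X_def by simp
    have XD2: "q ^ 2 \<le> X * D"
    proof -
      have "2 * q ^ 2 < X * D + D" unfolding X_def using D(1) by (metis div_mult_mod_eq mod_less_divisor nat_add_left_cancel_less Suc_le_lessD One_nat_def)
      then show ?thesis using D(2) qq by linarith
    qed
    have X0: "X > 0" using XD2 q by (cases X) auto
    have rXD: "M \<le> real X * real D" "real X * real D \<le> 2 * M"
      using of_nat_mono[OF XD2, where 'a = real] of_nat_mono[OF XD, where 'a = real] by (simp_all add: M_def)
    have M0: "M > 0" using q by (simp add: M_def)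
    have S: "S h ^ n * real X ^ Suc j \<le> C1 * real X ^ n * W h" for h
    proof -
      define p where "p = smult (real h) (pcompose f [:c, real (4 * D):])"
      have D0: "real (4 * D) \<noteq> 0" using D(1) by simp
      have dp: "degree (pcompose f [:c, real (4 * D):]) = Suc j" using deg D0 by (simp add: degree_pcompose)
      then have "degree p \<le> Suc j" unfolding p_def by (metis degree_smult_le)
      from poly_phase_poly[OF this]
      have ph: "poly_phase (Suc j) (coeff p (Suc j)) (\<lambda>t. poly p (real t))" .
      have lc: "lead_coeff (pcompose f [:c, real (4 * D):]) = \<alpha> * real (4 * D) ^ Suc j"
        using D0 by (subst lead_coeff_comp) (simp_all add: deg \<alpha>_def)
      have cp: "coeff p (Suc j) = real h * (\<alpha> * real (4 * D) ^ Suc j)"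
        using lc unfolding dp by (simp add: p_def)
      have "fact (Suc j) * coeff p (Suc j) = real h * (real (fact (Suc j) * (4 * D) ^ Suc j) * \<alpha>)"
        unfolding cp of_nat_mult of_nat_fact of_nat_power by (simp only: mult_ac)
      then show ?thesis
        using weyl[OF ph YX X0] unfolding S_def n_def W_def
        by (simp only:) (simp add: p_def poly_pcompose mult_ac)
    qed
    have Snn: "S h \<ge> 0" for h by (simp add: S_def)
    have ES: "E \<le> (\<Sum>h=1..L. S h)"
      unfolding E_def exp_sum_total_def S_def by (intro sum_mono2) auto
    have E0: "E \<ge> 0" unfolding E_def by (rule exp_sum_total_nonneg)
    have "real L * E ^ n \<le> real L * (\<Sum>h=1..L. S h) ^ n"
      using ES E0 by (intro mult_left_mono power_mono) auto
    also have "\<dots> \<le> real L ^ n * (\<Sum>h=1..L. S h ^ n)"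
      using sum_power_two_power_le[of "{1..L}" S j] Snn by (simp add: n_def)
    finally have "real L * E ^ n * real X ^ Suc j \<le> real L ^ n * (\<Sum>h=1..L. S h ^ n) * real X ^ Suc j"
      by (intro mult_right_mono) auto
    also have "\<dots> = real L ^ n * (\<Sum>h=1..L. S h ^ n * real X ^ Suc j)"
      by (simp only: sum_distrib_right mult.assoc)
    also have "\<dots> \<le> real L ^ n * (\<Sum>h=1..L. C1 * real X ^ n * W h)"
      by (intro mult_left_mono sum_mono S) auto
    also have "\<dots> = real L ^ n * (C1 * real X ^ n * (\<Sum>h=1..L. W h))"
      by (simp only: sum_distrib_left)
    also have "\<dots> \<le> real L ^ n * (C1 * real X ^ n * (K * (T ^ j * (1 + ln (real q))) * (real L * M ^ j * real q)))"
      unfolding W_def K_def M_def using C1 q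
      by (intro mult_left_mono sum_weyl_sum_progression_le[OF aq[folded \<alpha>_def] q L D X0 XD T]) auto
    also have "\<dots> \<le> real L ^ n * (C1 * real X ^ n * (K * (C2 * real q powr \<eta>) * (real L * M ^ j * real q)))"
      using C1 K M0 by (intro mult_left_mono mult_right_mono Tl) auto
    finally have le: "real L * E ^ n * real X ^ Suc j
      \<le> real L ^ n * (C1 * real X ^ n * (K * (C2 * real q powr \<eta>) * (real L * M ^ j * real q)))" .
    have "(E ^ n * real q) * (real L * M ^ j * real q) = real L * E ^ n * M ^ Suc j"
      unfolding power_Suc M_def by (simp only: mult_ac power2_eq_square)
    also have "\<dots> \<le> real L * E ^ n * (real X * real D) ^ Suc j"
      using rXD M0 E0 by (intro mult_left_mono power_mono) auto
    also have "\<dots> = real L * E ^ n * real X ^ Suc j * real D ^ Suc j" by (simp only: power_mult_distrib mult.assoc)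
    also have "\<dots> \<le> real L ^ n * (C1 * real X ^ n * (K * (C2 * real q powr \<eta>) * (real L * M ^ j * real q))) * real D ^ Suc j"
      using le by (rule mult_right_mono) simp
    also have "\<dots> = real L ^ n * (C1 * (K * (C2 * real q powr \<eta>) * (real L * M ^ j * real q))) * (real X ^ n * real D ^ Suc j)"
      by (simp only: mult_ac)
    also have "\<dots> \<le> real L ^ n * (C1 * (K * (C2 * real q powr \<eta>) * (real L * M ^ j * real q))) * (2 ^ n * M ^ n)"
    proof (rule mult_left_mono)
      \<comment> \<open>Uses \<open>j + 1 \<le> 2 ^ j = n\<close>, so that the powers of
        \<open>D\<close> lost in returning from \<open>X\<close> to \<open>q ^ 2\<close> are covered
        by those of \<open>X D\<close>.\<close>
      have "real X ^ n * real D ^ Suc j \<le> real X ^ n * real D ^ n"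
        using D(1) n by (intro mult_left_mono power_increasing) auto
      also have "\<dots> = (real X * real D) ^ n" by (simp add: power_mult_distrib)
      also have "\<dots> \<le> (2 * M) ^ n" using rXD by (intro power_mono) auto
      finally show "real X ^ n * real D ^ Suc j \<le> 2 ^ n * M ^ n" by (simp add: power_mult_distrib)
    qed (use C1 C2 K M0 in auto)
    also have "\<dots> = (C * real q powr \<eta> * (real L * M) ^ n) * (real L * M ^ j * real q)"
      unfolding C_def power_mult_distrib by (simp only: mult_ac)
    finally have "(E ^ n * real q) * (real L * M ^ j * real q) \<le> (C * real q powr \<eta> * (real L * M) ^ n) * (real L * M ^ j * real q)" .
    moreover have "real L * M ^ j * real q > 0" using L(1) M0 q by simp
    ultimately have "E ^ n * real q \<le> C * real q powr \<eta> * (real L * M) ^ n"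
      by (rule mult_right_le_imp_le)
    then show "exp_sum_total L {..<Y} (\<lambda>t. poly f (c + real (4 * d ^ 2) * real t)) ^ (2 ^ j) * real q
       \<le> C * real q powr \<eta> * (real L * real q ^ 2) ^ (2 ^ j)"
      unfolding E_def n_def M_def D_def .
  qed
qed

section \<open>Squarefree numbers\<close>

text \<open>An even square would be divisible by 4, which \<open>4 * m + 2\<close> is not.\<close>

lemma odd_square_dvd_if_not_squarefree:
  fixes m :: nat
  assumes "\<not> squarefree (4 * m + 2)"
  obtains i where "i \<ge> 1" "(2 * i + 1)\<^sup>2 dvd 4 * m + 2"
proof -
  obtain x :: nat where x: "x\<^sup>2 dvd 4 * m + 2" "x \<noteq> 1"
    using assms by (auto simp: squarefree_def)
  have "odd x"
  proof
    assume "even x"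
    then have "2\<^sup>2 dvd x\<^sup>2" by (rule dvd_power_same)
    with x(1) have "2\<^sup>2 dvd 4 * m + 2" by (rule dvd_trans[rotated])
    then have "4 dvd 4 * m + 2" by simp
    then show False by presburger
  qed
  then obtain i where "x = 2 * i + 1" by (elim oddE)
  then show ?thesis using x that[of i] by (cases "i = 0") auto
qed

lemma card_prime_factors_ge_2:
  fixes m :: nat
  assumes "m \<ge> 1"
  shows "card (prime_factors (4 * m + 2)) \<ge> 2"
proof -
  obtain p where p: "prime p" "p dvd 2 * m + 1"
    using prime_factor_nat[of "2 * m + 1"] assms by auto
  have "odd (2 * m + 1)" by simp
  then have "p \<noteq> 2" using p(2) by auto
  have "4 * m + 2 = 2 * (2 * m + 1)" by simp
  then have "p dvd 4 * m + 2" "2 dvd 4 * m + 2" using p(2) by (metis dvd_mult, metis dvd_triv_left)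
  then have "{2, p} \<subseteq> prime_factors (4 * m + 2)"
    using p(1) by (auto simp: prime_factors_dvd)
  from card_mono[OF _ this] \<open>p \<noteq> 2\<close> show ?thesis by simp
qed

text \<open>For odd \<open>d\<close> the square is coprime to 4, so the solutions form one residue
  class; \<open>m0\<close> is the least one in the interval. It is itself counted in
  \<open>Y\<close>, hence the extra square of \<open>d\<close> in the bound. The case without
  solutions is covered by \<open>Y = 0\<close>.\<close>

lemma progression_of_odd_square:
  fixes d M :: nat
  assumes "odd d"
  obtains m0 Y where "Y * d\<^sup>2 \<le> M + d\<^sup>2"
    "{m \<in> {M..<2 * M}. d\<^sup>2 dvd 4 * m + 2} = (\<lambda>t. m0 + d\<^sup>2 * t) ` {..<Y}"
proof (cases "{m \<in> {M..<2 * M}. d\<^sup>2 dvd 4 * m + 2} = {}")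
  case True
  then show ?thesis using that[of 0 0] by simp
next
  case False
  define S where "S = {m \<in> {M..<2 * M}. d\<^sup>2 dvd 4 * m + 2}"
  define m0 where "m0 = Min S"
  define D where "D = d\<^sup>2"
  define Y where "Y = (2 * M - 1 - m0) div D + 1"
  have fin: "finite S" by (simp add: S_def)
  have m0: "m0 \<in> S" unfolding m0_def using False fin by (intro Min_in) (auto simp: S_def)
  then have m0M: "M \<le> m0" "m0 < 2 * M" "D dvd 4 * m0 + 2" by (auto simp: S_def D_def)
  have D0: "D > 0" using assms by (auto simp: D_def intro: Nat.gr0I)
  have cop: "coprime D 4"
    using assms coprime_power_right_iff[of D 2 2] by (simp add: D_def)
  have Yiff: "t < Y \<longleftrightarrow> m0 + D * t < 2 * M" for t
  proof -
    have "t < Y \<longleftrightarrow> t \<le> (2 * M - 1 - m0) div D" by (auto simp: Y_def)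
    also have "\<dots> \<longleftrightarrow> t * D \<le> 2 * M - 1 - m0" by (rule less_eq_div_iff_mult_less_eq[OF D0])
    also have "\<dots> \<longleftrightarrow> m0 + D * t < 2 * M" using m0M(2) by (auto simp: mult.commute)
    finally show ?thesis .
  qed
  have "S = (\<lambda>t. m0 + D * t) ` {..<Y}"
  proof (intro equalityI subsetI)
    fix m assume m: "m \<in> S"
    then have le: "m0 \<le> m" unfolding m0_def using fin by simp
    have "D dvd (4 * m + 2) - (4 * m0 + 2)" using m m0M(3) by (intro dvd_diff_nat) (auto simp: S_def D_def)
    then have "D dvd 4 * (m - m0)" by (simp add: diff_mult_distrib2)
    then have "D dvd m - m0" using cop by (simp add: coprime_dvd_mult_right_iff)
    then obtain t where "m - m0 = D * t" by (elim dvdE)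
    then have t: "m = m0 + D * t" using le by simp
    then have "t < Y" using m unfolding Yiff by (simp add: S_def)
    then show "m \<in> (\<lambda>t. m0 + D * t) ` {..<Y}" using t by blast
  next
    fix m assume "m \<in> (\<lambda>t. m0 + D * t) ` {..<Y}"
    then obtain t where t: "m = m0 + D * t" "t < Y" by auto
    have "D dvd (4 * m0 + 2) + D * (4 * t)" using m0M(3) by (rule dvd_add) (rule dvd_triv_left)
    also have "(4 * m0 + 2) + D * (4 * t) = 4 * m + 2" by (simp add: t(1))
    finally have "D dvd 4 * m + 2" .
    then show "m \<in> S" using t m0M(1) Yiff[of t] by (simp add: S_def D_def)
  qed
  moreover have "Y * D \<le> M + D"
  proof -
    have "(2 * M - 1 - m0) div D * D \<le> 2 * M - 1 - m0" by simp
    then show ?thesis unfolding Y_def add_mult_distrib using m0M(1) by linarith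
  qed
  ultimately show ?thesis using that[of Y m0] by (simp add: S_def D_def)
qed

text \<open>Since the square of \<open>2 i + 1\<close> exceeds \<open>4 i (i + 1)\<close>, the sum
  is dominated by a telescoping one.\<close>

lemma sum_inverse_odd_squares_le:
  assumes "1 \<le> a"
  shows "(\<Sum>i=a..b. 1 / (real (2 * i + 1))\<^sup>2) \<le> 1 / (4 * real a)"
proof -
  have tel: "(\<Sum>i=a..<a + n. 1 / (real (2 * i + 1))\<^sup>2) \<le> (1 / real a - 1 / real (a + n)) / 4" for n
  proof (induction n)
    case (Suc n)
    define i where "i = real (a + n)"
    have i: "i \<ge> 1" using assms by (simp add: i_def)
    have "1 / (2 * i + 1)\<^sup>2 \<le> 1 / (4 * (i * (i + 1)))"
    proof (rule frac_le)
      show "0 < 4 * (i * (i + 1))" using i by simp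
    qed (auto simp: power2_eq_square algebra_simps)
    also have "\<dots> = (1 / i - 1 / (i + 1)) / 4" using i by (simp add: field_simps)
    finally have "1 / (real (2 * (a + n) + 1))\<^sup>2 \<le> (1 / real (a + n) - 1 / real (a + Suc n)) / 4"
      by (simp add: i_def algebra_simps)
    then show ?case using Suc by simp
  qed simp
  show ?thesis
  proof (cases "a \<le> b + 1")
    case True
    have "{a..b} = {a..<a + (b + 1 - a)}" using True by auto
    then have "(\<Sum>i=a..b. 1 / (real (2 * i + 1))\<^sup>2) \<le> (1 / real a - 1 / real (a + (b + 1 - a))) / 4"
      using tel[of "b + 1 - a"] by simp
    also have "\<dots> \<le> (1 / real a) / 4" by (intro divide_right_mono) auto
    finally show ?thesis by simp
  next
    case False
    then show ?thesis by simp
  qed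
qed

section \<open>Sieving out the multiples of odd squares\<close>

lemma sum_UN_le_sum:
  fixes g :: "'b \<Rightarrow> real"
  assumes "finite I" "\<And>i. i \<in> I \<Longrightarrow> finite (S i)" "\<And>x. g x \<ge> 0"
  shows "sum g (\<Union>i\<in>I. S i) \<le> (\<Sum>i\<in>I. sum g (S i))"
  using assms
proof (induction I rule: finite_induct)
  case (insert i I)
  have "sum g (S i \<union> (\<Union>i\<in>I. S i)) \<le> sum g (S i) + sum g (\<Union>i\<in>I. S i)"
    using insert by (subst sum_Un) (auto intro!: sum_nonneg)
  also have "sum g (\<Union>i\<in>I. S i) \<le> (\<Sum>i\<in>I. sum g (S i))" using insert by simp
  finally show ?case using insert by simp
qed simp

lemma exp_sum_total_image:
  assumes "inj_on g S"
  shows "exp_sum_total L (g ` S) x = exp_sum_total L S (\<lambda>t. x (g t))"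
  unfolding exp_sum_total_def by (simp add: sum.reindex[OF assms])

text \<open>If all values at squarefree \<open>4 m + 2\<close> were at least \<open>1 / L\<close>
  away from the integers, the set \<open>B\<close> of the remaining \<open>m\<close> would carry
  nearly half of the total kernel mass. But \<open>B\<close> is covered by the progressions
  \<open>P i\<close>, whose total mass is smaller.\<close>

lemma squarefree_poly_near_integer:
  fixes f :: "real poly" and q L :: nat
  assumes L: "even L" "L > 0" "96 * L \<le> q"
    and E: "\<And>i c Y. i \<le> 4 * L \<Longrightarrow> Y * (2 * i + 1)\<^sup>2 \<le> 2 * q\<^sup>2 \<Longrightarrow>
      exp_sum_total L {..<Y} (\<lambda>t. poly f (c + real (4 * (2 * i + 1)\<^sup>2) * real t)) * (200 * real L) \<le> real q ^ 2"
  shows "\<exists>m\<in>{q\<^sup>2..<2 * q\<^sup>2}. squarefree (4 * m + 2) \<and> dist_nearest_int (poly f (real (4 * m + 2))) < 1 / real L"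
proof (rule ccontr)
  assume contra: "\<not> ?thesis"
  define M where "M = q\<^sup>2"
  define R where "R = real M"
  define A where "A = {M..<2 * M}"
  define x where "x m = poly f (real (4 * m + 2))" for m
  define B where "B = {m \<in> A. \<not> squarefree (4 * m + 2)}"
  define d where "d i = 2 * i + 1" for i :: nat
  define P where "P i = {m \<in> A. (d i)\<^sup>2 dvd 4 * m + 2}" for i
  define F where "F = fejer_kernel L"
  define r where "r = real L"
  have r: "r \<ge> 1" using L by (simp add: r_def)
  have q: "q \<ge> 96" using L by linarith
  have R: "R = real q * real q" by (simp add: R_def M_def power2_eq_square)
  have rq: "96 * r \<le> real q" using L(3) by (simp add: r_def)
  have F0: "F y \<ge> 0" for y unfolding F_def by (rule fejer_kernel_nonneg)
  have finA: "finite A" by (simp add: A_def)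
  have finP: "finite (P i)" for i using finA by (simp add: P_def)
  have prog: "\<exists>m0 Y. Y * (d i)\<^sup>2 \<le> M + (d i)\<^sup>2 \<and> P i = (\<lambda>t. m0 + (d i)\<^sup>2 * t) ` {..<Y}" for i
  proof (rule progression_of_odd_square[of "d i" M])
    show "odd (d i)" by (simp add: d_def)
  qed (auto simp: P_def A_def)
  have inj: "inj_on (\<lambda>t. m0 + (d i)\<^sup>2 * t) {..<Y}" for m0 Y i
    by (auto simp: inj_on_def d_def)
  have cardP: "real (card (P i)) \<le> R / (real (d i))\<^sup>2 + 1" for i
  proof -
    obtain m0 Y where Y: "Y * (d i)\<^sup>2 \<le> M + (d i)\<^sup>2" "P i = (\<lambda>t. m0 + (d i)\<^sup>2 * t) ` {..<Y}"
      using prog by blast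
    have "card (P i) = Y" unfolding Y(2) using inj by (simp add: card_image)
    moreover have "real Y * (real (d i))\<^sup>2 \<le> R + (real (d i))\<^sup>2"
      using of_nat_mono[OF Y(1), where 'a = real] by (simp add: R_def)
    moreover have "(real (d i))\<^sup>2 > 0" by (simp add: d_def)
    ultimately show ?thesis by (simp add: field_simps)
  qed
  have EP: "exp_sum_total L (P i) x * (200 * r) \<le> R" if i: "i \<le> 4 * L" for i
  proof -
    obtain m0 Y where Y: "Y * (d i)\<^sup>2 \<le> M + (d i)\<^sup>2" "P i = (\<lambda>t. m0 + (d i)\<^sup>2 * t) ` {..<Y}"
      using prog by blast
    have "d i \<le> q" using i L by (simp add: d_def)
    then have "(d i)\<^sup>2 \<le> M" unfolding M_def by (rule power_mono) simp
    then have Y2: "Y * (2 * i + 1)\<^sup>2 \<le> 2 * q\<^sup>2" using Y(1) unfolding M_def d_def by linarith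
    have "exp_sum_total L (P i) x = exp_sum_total L {..<Y} (\<lambda>t. x (m0 + (d i)\<^sup>2 * t))"
      unfolding Y(2) by (rule exp_sum_total_image[OF inj])
    also have "(\<lambda>t. x (m0 + (d i)\<^sup>2 * t)) = (\<lambda>t. poly f (real (4 * m0 + 2) + real (4 * (2 * i + 1)\<^sup>2) * real t))"
    proof
      fix t
      have "real (4 * (m0 + (d i)\<^sup>2 * t) + 2) = real (4 * m0 + 2) + real (4 * (2 * i + 1)\<^sup>2) * real t"
        unfolding d_def of_nat_mult[symmetric] of_nat_add[symmetric] of_nat_eq_iff
        by (simp only: distrib_left mult.assoc add_ac)
      then show "x (m0 + (d i)\<^sup>2 * t) = poly f (real (4 * m0 + 2) + real (4 * (2 * i + 1)\<^sup>2) * real t)"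
        unfolding x_def by (simp only:)
    qed
    finally show ?thesis using E[OF i Y2, of "real (4 * m0 + 2)"] unfolding r_def R_def M_def by simp
  qed
  \<comment> \<open>The index 0 belongs to the modulus 1, so the hypothesis on exponential sums also
    covers the full interval.\<close>
  have P0: "P 0 = A" by (simp add: P_def d_def)
  have far: "dist_nearest_int (x m) \<ge> 1 / real L" if "m \<in> A - B" for m
    using that contra unfolding A_def B_def x_def M_def by (auto simp: not_less)
  have BA: "B \<subseteq> A" by (auto simp: B_def)
  have main: "r / 2 * (R - 3 * exp_sum_total L A x) \<le> 2 * (\<Sum>m\<in>B. F (x m))"
    using sum_fejer_kernel_exceptional_ge[OF L(1,2) finA BA far] by (simp add: A_def r_def R_def F_def)
  have EA: "exp_sum_total L A x \<le> R / 200"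
  proof -
    have "exp_sum_total L A x * 200 \<le> exp_sum_total L A x * (200 * r)"
      using r by (intro mult_left_mono exp_sum_total_nonneg) auto
    then show ?thesis using EP[of 0, unfolded P0, OF le0] by linarith
  qed
  have BP: "B \<subseteq> (\<Union>i\<in>{1..2 * q}. P i)"
  proof
    fix m assume m: "m \<in> B"
    then have "\<not> squarefree (4 * m + 2)" by (simp add: B_def)
    then obtain i where i: "i \<ge> 1" "(d i)\<^sup>2 dvd 4 * m + 2"
      unfolding d_def by (rule odd_square_dvd_if_not_squarefree)
    have "i \<le> 2 * q"
    proof (rule ccontr)
      assume "\<not> i \<le> 2 * q"
      then have "4 * q \<le> d i" by (simp add: d_def)
      then have "(4 * q)\<^sup>2 \<le> (d i)\<^sup>2" by (rule power_mono) simp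
      also have "(d i)\<^sup>2 \<le> 4 * m + 2" using i(2) by (rule dvd_imp_le) simp
      also have "4 * m + 2 < 8 * q\<^sup>2" using m by (auto simp: B_def A_def M_def)
      finally show False by (simp add: power_mult_distrib)
    qed
    then show "m \<in> (\<Union>i\<in>{1..2 * q}. P i)" using i m by (auto simp: P_def B_def)
  qed
  have small: "(\<Sum>m\<in>P i. F (x m)) \<le> r / 2 * (R * (1 / (real (d i))\<^sup>2) + (1 + R / (100 * r)))" if i: "i \<le> 4 * L" for i
  proof -
    have "exp_sum_total L (P i) x \<le> R / (200 * r)" using EP[OF i] r by (simp add: field_simps)
    then have "r * exp_sum_total L (P i) x \<le> r * (R / (200 * r))" using r by (intro mult_left_mono) auto
    moreover have "r / 2 * real (card (P i)) \<le> r / 2 * (R / (real (d i))\<^sup>2 + 1)"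
      using r cardP[of i] by (intro mult_left_mono) auto
    moreover have "(\<Sum>m\<in>P i. F (x m)) \<le> r / 2 * real (card (P i)) + r * exp_sum_total L (P i) x"
      using sum_fejer_kernel[OF L(1,2), of x "P i"] unfolding F_def r_def by linarith
    ultimately have "(\<Sum>m\<in>P i. F (x m)) \<le> r / 2 * (R / (real (d i))\<^sup>2 + 1) + r * (R / (200 * r))"
      by linarith
    moreover have "r * (R / (200 * r)) = r / 2 * (R / (100 * r))" using r by simp
    ultimately show ?thesis by (simp add: distrib_left)
  qed
  have large: "(\<Sum>m\<in>P i. F (x m)) \<le> r / 2 * r * (R * (1 / (real (d i))\<^sup>2) + 1)" for i
  proof -
    have "(\<Sum>m\<in>P i. F (x m)) \<le> (\<Sum>m\<in>P i. r * (r / 2))"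
      unfolding F_def r_def by (intro sum_mono fejer_kernel_le L)
    also have "\<dots> = real (card (P i)) * (r * (r / 2))" by simp
    also have "\<dots> \<le> (R / (real (d i))\<^sup>2 + 1) * (r * (r / 2))"
      using r cardP[of i] by (intro mult_right_mono) auto
    finally show ?thesis by (simp add: mult_ac)
  qed
  have affine: "(\<Sum>i\<in>I. u * (R * w i + v)) = u * (R * (\<Sum>i\<in>I. w i) + real (card I) * v)"
    for I u v and w :: "nat \<Rightarrow> real"
    by (simp only: sum_distrib_left[symmetric] sum.distrib sum_constant)
  \<comment> \<open>Up to \<open>4 * L\<close> the exponential sum bound is used. Beyond, the
    trivial bound loses a factor \<open>L\<close>, which the tail of the sum of inverse squares, at
    most \<open>1 / (16 L)\<close>, makes up for.\<close>
  have split: "{1..2 * q} = {1..4 * L} \<union> {4 * L + 1..2 * q}" using L by auto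
  have "(\<Sum>m\<in>B. F (x m)) \<le> (\<Sum>m\<in>(\<Union>i\<in>{1..2 * q}. P i). F (x m))"
    using BP F0 finP by (intro sum_mono2) auto
  also have "\<dots> \<le> (\<Sum>i\<in>{1..2 * q}. \<Sum>m\<in>P i. F (x m))"
    using finP F0 by (intro sum_UN_le_sum) auto
  also have "\<dots> = (\<Sum>i=1..4 * L. \<Sum>m\<in>P i. F (x m)) + (\<Sum>i=4 * L + 1..2 * q. \<Sum>m\<in>P i. F (x m))"
    unfolding split by (rule sum.union_disjoint) auto
  also have "\<dots> \<le> (\<Sum>i=1..4 * L. r / 2 * (R * (1 / (real (d i))\<^sup>2) + (1 + R / (100 * r))))
      + (\<Sum>i=4 * L + 1..2 * q. r / 2 * r * (R * (1 / (real (d i))\<^sup>2) + 1))"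
  proof (rule add_mono)
    show "(\<Sum>i=1..4 * L. \<Sum>m\<in>P i. F (x m)) \<le> (\<Sum>i=1..4 * L. r / 2 * (R * (1 / (real (d i))\<^sup>2) + (1 + R / (100 * r))))"
      by (rule sum_mono, rule small) simp
    show "(\<Sum>i=4 * L + 1..2 * q. \<Sum>m\<in>P i. F (x m)) \<le> (\<Sum>i=4 * L + 1..2 * q. r / 2 * r * (R * (1 / (real (d i))\<^sup>2) + 1))"
      by (rule sum_mono) (rule large)
  qed
  also have "\<dots> = r / 2 * (R * (\<Sum>i=1..4 * L. 1 / (real (d i))\<^sup>2) + real (card {1..4 * L}) * (1 + R / (100 * r)))
      + r / 2 * r * (R * (\<Sum>i=4 * L + 1..2 * q. 1 / (real (d i))\<^sup>2) + real (card {4 * L + 1..2 * q}) * 1)"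
    unfolding affine ..
  also have "real (card {1..4 * L}) = 4 * r" by (simp add: r_def)
  also have "real (card {4 * L + 1..2 * q}) * 1 = real (2 * q - 4 * L)" by simp
  finally have upper: "(\<Sum>m\<in>B. F (x m)) \<le> r / 2 * (R * (\<Sum>i=1..4 * L. 1 / (real (d i))\<^sup>2) + 4 * r * (1 + R / (100 * r)))
     + r / 2 * r * (R * (\<Sum>i=4 * L + 1..2 * q. 1 / (real (d i))\<^sup>2) + real (2 * q - 4 * L))" .
  have R0: "R > 0" using q by (simp add: R)
  have s1: "R * (\<Sum>i=1..4 * L. 1 / (real (d i))\<^sup>2) \<le> R * (1 / 4)"
    using sum_inverse_odd_squares_le[of 1 "4 * L"] R0 unfolding d_def by (intro mult_left_mono) auto
  have s2: "r * (R * (\<Sum>i=4 * L + 1..2 * q. 1 / (real (d i))\<^sup>2)) \<le> R / 16"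
  proof -
    have "(\<Sum>i=4 * L + 1..2 * q. 1 / (real (d i))\<^sup>2) \<le> 1 / (4 * real (4 * L + 1))"
      unfolding d_def by (rule sum_inverse_odd_squares_le) simp
    also have "\<dots> \<le> 1 / (16 * r)" using r by (intro divide_left_mono) (auto simp: r_def)
    finally have "r * (R * (\<Sum>i=4 * L + 1..2 * q. 1 / (real (d i))\<^sup>2)) \<le> r * (R * (1 / (16 * r)))"
      using r R0 by (intro mult_left_mono) auto
    then show ?thesis using r by simp
  qed
  have s3: "r * real (2 * q - 4 * L) \<le> R / 48"
  proof -
    have "r * real (2 * q - 4 * L) \<le> r * (2 * real q)" using r by (intro mult_left_mono) auto
    also have "\<dots> = (96 * r) * real q / 48" by simp
    also have "\<dots> \<le> real q * real q / 48" using rq by (intro divide_right_mono mult_right_mono) auto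
    finally show ?thesis by (simp add: R)
  qed
  have s4: "4 * r * (1 + R / (100 * r)) \<le> R / 20"
  proof -
    have "96 * r * 96 \<le> real q * real q" using rq q r by (intro mult_mono) auto
    then have "4 * r \<le> R / 100" using r unfolding R[symmetric] by simp
    moreover have "4 * r * (1 + R / (100 * r)) = 4 * r + R / 25" using r by (simp add: field_simps)
    moreover have "R / 100 + R / 25 = R / 20" by simp
    ultimately show ?thesis by linarith
  qed
  \<comment> \<open>The shares of \<open>R\<close> are \<open>1 / 4\<close> for the small moduli,
    \<open>1 / 20\<close> for their errors, \<open>1 / 16\<close> for the tail and
    \<open>1 / 48\<close> for the rounding errors of at most \<open>2 q\<close> progressions. Twice
    their sum is \<open>23 / 30\<close>, below the \<open>1 - 3 / 200\<close> that remains on the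
    left.\<close>
  have "r / 2 * (R - 3 * exp_sum_total L A x) \<le> r / 2 * (2 * (R * (1 / 4) + R / 20 + (R / 16 + R / 48)))"
  proof -
    have "(\<Sum>m\<in>B. F (x m)) \<le> r / 2 * ((R * (\<Sum>i=1..4 * L. 1 / (real (d i))\<^sup>2) + 4 * r * (1 + R / (100 * r)))
       + (r * (R * (\<Sum>i=4 * L + 1..2 * q. 1 / (real (d i))\<^sup>2)) + r * real (2 * q - 4 * L)))"
      using upper by (simp only: distrib_left mult.assoc)
    also have "\<dots> \<le> r / 2 * ((R * (1 / 4) + R / 20) + (R / 16 + R / 48))"
      using r by (intro mult_left_mono add_mono s1 s2 s3 s4) auto
    finally show ?thesis using main by linarith
  qed
  then have "R - 3 * exp_sum_total L A x \<le> 2 * (R * (1 / 4) + R / 20 + (R / 16 + R / 48))"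
    using r by (simp only: mult_le_cancel_left)
  then show False using EA R0 by (simp add: field_simps)
qed

section \<open>Choice of parameters and conclusion\<close>

lemma const_mult_powr_le:
  fixes K s :: real
  assumes "s < 1"
  shows "\<exists>Q. \<forall>x\<ge>Q. K * x powr s \<le> x"
proof (intro exI allI impI)
  define Q where "Q = max 1 ((max K 1) powr (1 / (1 - s)))"
  fix x assume x: "x \<ge> Q"
  then have x1: "x \<ge> 1" by (simp add: Q_def)
  have "max K 1 = ((max K 1) powr (1 / (1 - s))) powr (1 - s)" using assms by (simp add: powr_powr)
  also have "\<dots> \<le> x powr (1 - s)" using x assms by (intro powr_mono2) (auto simp: Q_def)
  finally have "K \<le> x powr (1 - s)" by simp
  then have "K * x powr s \<le> x powr (1 - s) * x powr s" by (intro mult_right_mono) auto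
  also have "\<dots> = x" using x1 by (simp add: powr_add[symmetric])
  finally show "K * x powr s \<le> x" .
qed

theorem theorem1p6:
  fixes f :: "real poly" and k :: nat and \<gamma> \<epsilon> :: real
  assumes "degree f = k" and "k \<ge> 1"
    and "lead_coeff f \<notin> \<rat>"
    and "\<gamma> = 4 powr (1 - real k)"
    and "\<epsilon> > 0"
  shows "infinite {n :: nat. n > 0 \<and> squarefree n \<and> card (prime_factors n) \<ge> 2 \<and>
           dist_nearest_int (poly f (real n)) < real n powr (- \<gamma> / 4 + \<epsilon>)}"
proof
  let ?S = "{n :: nat. n > 0 \<and> squarefree n \<and> card (prime_factors n) \<ge> 2 \<and>
           dist_nearest_int (poly f (real n)) < real n powr (- \<gamma> / 4 + \<epsilon>)}"
  assume "finite ?S"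
  then obtain N where N: "\<And>n. n \<in> ?S \<Longrightarrow> n \<le> N" using finite_nat_set_iff_bounded_le[of ?S] by blast
  obtain j where j: "k = Suc j" using assms(2) by (cases k) auto
  define n :: nat where "n = 2 ^ j"
  define g where "g = 1 / (4::real) ^ k"
  \<comment> \<open>The minimum with \<open>g / 2\<close> keeps \<delta> positive when \<epsilon> is
    large.\<close>
  define \<epsilon>0 where "\<epsilon>0 = min \<epsilon> (g / 2)"
  define \<delta> where "\<delta> = g - \<epsilon>0"
  have g0: "g > 0" by (simp add: g_def)
  have \<gamma>: "\<gamma> / 4 = g" unfolding assms(4) g_def by (simp add: powr_diff powr_realpow)
  have \<epsilon>0: "\<epsilon>0 > 0" "\<epsilon>0 \<le> \<epsilon>" using g0 assms(5) by (auto simp: \<epsilon>0_def)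
  have \<delta>0: "\<delta> > 0" using g0 by (auto simp: \<delta>_def \<epsilon>0_def min_def)
  have n1: "n \<ge> 1" by (simp add: n_def)
  \<comment> \<open>Here the exponent of the theorem enters: with \<open>L\<close> about
    \<open>q\<close> to the power \<open>2 * \<delta>\<close>, the loss \<open>L ^ (2 * n)\<close>
    stays below the saving \<open>q\<close> by a factor \<open>q\<close> to the power
    \<open>4 * \<epsilon>0\<close>.\<close>
  have ng: "4 * real n * g \<le> 1"
  proof -
    have "(4::real) ^ j = 2 ^ j * 2 ^ j" by (subst power_mult_distrib[symmetric]) simp
    then have "4 * real n * g = 1 / 2 ^ j" unfolding n_def g_def j by simp
    then show ?thesis by simp
  qed
  have n\<delta>: "4 * real n * \<delta> \<le> 1 - 4 * \<epsilon>0"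
  proof -
    have "4 * 1 * \<epsilon>0 \<le> 4 * real n * \<epsilon>0" using n1 \<epsilon>0 by (intro mult_right_mono mult_left_mono) auto
    then show ?thesis using ng by (simp add: \<delta>_def right_diff_distrib)
  qed
  have \<delta>1: "4 * \<delta> \<le> 1 - 4 * \<epsilon>0"
  proof -
    have "4 * 1 * \<delta> \<le> 4 * real n * \<delta>" using n1 \<delta>0 by (intro mult_right_mono mult_left_mono) auto
    then show ?thesis using n\<delta> by simp
  qed
  obtain C where C: "C > 0" and weyl: "\<And>a q L d Y c. coprime a (int q) \<Longrightarrow> \<bar>lead_coeff f - of_int a / real q\<bar> \<le> 1 / real q ^ 2 \<Longrightarrow>
     q \<ge> 1 \<Longrightarrow> 1 \<le> L \<Longrightarrow> L \<le> q ^ 2 \<Longrightarrow> 1 \<le> d \<Longrightarrow> d ^ 2 \<le> q \<Longrightarrow> Y * d ^ 2 \<le> 2 * q ^ 2 \<Longrightarrow>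
     exp_sum_total L {..<Y} (\<lambda>t. poly f (c + real (4 * d ^ 2) * real t)) ^ (2 ^ j) * real q
       \<le> C * real q powr \<epsilon>0 * (real L * real q ^ 2) ^ (2 ^ j)"
    by (rule exp_sum_total_poly_le[OF assms(1)[unfolded j] \<epsilon>0(1) that]) assumption+
  have s1: "2 * \<delta> < 1" and s2: "4 * \<delta> < 1" and s3: "1 - 3 * \<epsilon>0 < 1"
    using \<delta>1 \<delta>0 \<epsilon>0 by linarith+
  \<comment> \<open>\<open>Q1\<close> ensures \<open>96 * L \<le> q\<close>; \<open>Q2\<close>
    ensures that the squares of all \<open>2 i + 1 \<le> 9 L\<close> are at most \<open>q\<close>;
    \<open>Q3\<close> absorbs the constants of the exponential sum estimate.\<close>
  obtain Q1 where Q1: "\<And>x. x \<ge> Q1 \<Longrightarrow> (96 * 32) * x powr (2 * \<delta>) \<le> x"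
    using const_mult_powr_le[OF s1] by blast
  obtain Q2 where Q2: "\<And>x. x \<ge> Q2 \<Longrightarrow> (9 * 32)\<^sup>2 * x powr (4 * \<delta>) \<le> x"
    using const_mult_powr_le[OF s2] by blast
  obtain Q3 where Q3: "\<And>x. x \<ge> Q3 \<Longrightarrow> (C * 200 ^ n * 32 ^ (2 * n)) * x powr (1 - 3 * \<epsilon>0) \<le> x"
    using const_mult_powr_le[OF s3] by blast
  \<comment> \<open>Irrationality of the leading coefficient provides good approximations with
    arbitrarily large denominators; one is taken beyond \<open>N\<close> and the three
    thresholds.\<close>
  have "infinite (approx_set (lead_coeff f))" using assms(3) rational_iff_finite_approx_set by blast
  from infinite_approx_set[OF this] obtain a q' where aq': "(a, q') \<in> approx_set (lead_coeff f)" "q' > \<lceil>max (max Q1 Q2) Q3\<rceil> + int N + 1 + \<bar>\<lceil>max (max Q1 Q2) Q3\<rceil>\<bar>"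
    by blast
  define q where "q = nat q'"
  have q'0: "q' > 0" "coprime a q'" "\<bar>lead_coeff f - of_int a / of_int q'\<bar> < 1 / (of_int q')\<^sup>2"
    using aq'(1) by (auto simp: approx_set_def)
  have q': "q' = int q" using q'0 by (simp add: q_def)
  have q1: "q \<ge> 1" using q'0(1) unfolding q' by simp
  have cop: "coprime a (int q)" using q'0(2) unfolding q' .
  have app: "\<bar>lead_coeff f - of_int a / real q\<bar> \<le> 1 / real q ^ 2" using q'0(3) unfolding q' by simp
  have qN: "q > N" using aq'(2) unfolding q' by linarith
  have qQ: "real q \<ge> Q1" "real q \<ge> Q2" "real q \<ge> Q3"
  proof -
    have "q' \<ge> \<lceil>max (max Q1 Q2) Q3\<rceil>" using aq'(2) by linarith
    then have "of_int q' \<ge> max (max Q1 Q2) Q3" by (simp add: ceiling_le_iff)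
    then show "real q \<ge> Q1" "real q \<ge> Q2" "real q \<ge> Q3" unfolding q' by auto
  qed
  \<comment> \<open>The base \<open>8 q ^ 2\<close> exceeds every \<open>4 m + 2\<close> with
    \<open>m < 2 q ^ 2\<close>, so \<open>1 / y\<close> is at most \<open>4 m + 2\<close> to the
    power \<open>-\<delta>\<close>. Twice the ceiling of \<open>y\<close> then gives an even
    \<open>L\<close> between \<open>y\<close> and \<open>4 y\<close>.\<close>
  define y where "y = (8 * real q ^ 2) powr \<delta>"
  define L where "L = 2 * nat \<lceil>y\<rceil>"
  have "1 \<le> real q ^ 2" using q1 by (intro one_le_power) simp
  then have y1: "y \<ge> 1" unfolding y_def using \<delta>0 by (intro ge_one_powr_ge_zero) auto
  have Ly: "y \<le> real L" "real L \<le> 4 * y" unfolding L_def using y1 by linarith+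
  have L0: "L > 0" "even L"
  proof -
    have "real L \<ge> 1" using Ly(1) y1 by linarith
    then show "L > 0" by simp
    show "even L" by (simp add: L_def)
  qed
  have yq: "y \<le> 8 * real q powr (2 * \<delta>)"
  proof -
    have "real q ^ 2 = real q powr 2" using q1 powr_realpow[of "real q" 2] by simp
    then have "y = 8 powr \<delta> * real q powr (2 * \<delta>)" by (simp only: y_def powr_mult powr_powr)
    moreover have "(8::real) powr \<delta> \<le> 8 powr 1" using \<delta>1 \<epsilon>0 by (intro powr_mono) auto
    ultimately show ?thesis by (simp add: mult_right_mono)
  qed
  have Lq: "real L \<le> 32 * real q powr (2 * \<delta>)" using Ly(2) yq by linarith
  have L96: "96 * L \<le> q"
  proof -
    have "96 * real L \<le> real q" using Lq Q1[OF qQ(1)] by linarith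
    then show ?thesis by linarith
  qed
  have LM: "L \<le> q ^ 2" using L96 power_increasing[of 1 2 q] q1 by simp
  have dq: "(2 * i + 1)\<^sup>2 \<le> q" if i: "i \<le> 4 * L" for i
  proof -
    have "real (2 * i + 1) \<le> 9 * real L" using i L0(1) by simp
    also have "\<dots> \<le> 9 * 32 * real q powr (2 * \<delta>)" using Lq by simp
    finally have "(real (2 * i + 1))\<^sup>2 \<le> (9 * 32 * real q powr (2 * \<delta>))\<^sup>2" by (intro power_mono) auto
    also have "\<dots> = (9 * 32)\<^sup>2 * real q powr (4 * \<delta>)"
      unfolding power_mult_distrib using q1 by (simp add: powr_power)
    also have "\<dots> \<le> real q" by (rule Q2[OF qQ(2)])
    finally have "real ((2 * i + 1)\<^sup>2) \<le> real q" by simp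
    then show ?thesis by (simp only: of_nat_le_iff)
  qed
  have "\<exists>m\<in>{q\<^sup>2..<2 * q\<^sup>2}. squarefree (4 * m + 2) \<and> dist_nearest_int (poly f (real (4 * m + 2))) < 1 / real L"
  proof (rule squarefree_poly_near_integer[OF L0(2,1) L96])
    fix i Y :: nat and c :: real
    assume i: "i \<le> 4 * L" and Y: "Y * (2 * i + 1)\<^sup>2 \<le> 2 * q\<^sup>2"
    define E where "E = exp_sum_total L {..<Y} (\<lambda>t. poly f (c + real (4 * (2 * i + 1)\<^sup>2) * real t))"
    have E0: "E \<ge> 0" unfolding E_def by (rule exp_sum_total_nonneg)
    have "E ^ n * real q \<le> C * real q powr \<epsilon>0 * (real L * real q ^ 2) ^ n"
      unfolding E_def n_def using L0 q1 dq[OF i] Y by (intro weyl[OF cop app] LM) auto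
    \<comment> \<open>One factor \<open>L\<close> comes from the number of frequencies, a second
      from the precision that the sieve requires; hence \<open>L ^ (2 * n)\<close>.\<close>
    then have "E ^ n * real q * (200 * real L) ^ n \<le> C * real q powr \<epsilon>0 * (real L * real q ^ 2) ^ n * (200 * real L) ^ n"
      by (rule mult_right_mono) simp
    also have "\<dots> = (C * 200 ^ n * real q powr \<epsilon>0 * real L ^ (2 * n)) * (real q ^ 2) ^ n"
      unfolding power_mult_distrib mult_2 power_add by (simp only: mult_ac)
    also have "\<dots> \<le> real q * (real q ^ 2) ^ n"
    proof (rule mult_right_mono)
      have "real L ^ (2 * n) \<le> (32 * real q powr (2 * \<delta>)) ^ (2 * n)" using Lq by (intro power_mono) auto
      also have "\<dots> = 32 ^ (2 * n) * real q powr (4 * real n * \<delta>)"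
        unfolding power_mult_distrib using q1 by (simp add: powr_power mult_ac)
      also have "\<dots> \<le> 32 ^ (2 * n) * real q powr (1 - 4 * \<epsilon>0)"
        using q1 n\<delta> by (intro mult_left_mono powr_mono) auto
      finally have "C * 200 ^ n * real q powr \<epsilon>0 * real L ^ (2 * n)
         \<le> C * 200 ^ n * real q powr \<epsilon>0 * (32 ^ (2 * n) * real q powr (1 - 4 * \<epsilon>0))"
        using C by (intro mult_left_mono) auto
      also have "\<dots> = (C * 200 ^ n * 32 ^ (2 * n)) * (real q powr \<epsilon>0 * real q powr (1 - 4 * \<epsilon>0))"
        by (simp only: mult_ac)
      also have "real q powr \<epsilon>0 * real q powr (1 - 4 * \<epsilon>0) = real q powr (1 - 3 * \<epsilon>0)"
        by (simp add: powr_add[symmetric])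
      also have "(C * 200 ^ n * 32 ^ (2 * n)) * real q powr (1 - 3 * \<epsilon>0) \<le> real q" by (rule Q3[OF qQ(3)])
      finally show "C * 200 ^ n * real q powr \<epsilon>0 * real L ^ (2 * n) \<le> real q" .
    qed auto
    finally have "(E * (200 * real L)) ^ n * real q \<le> (real q ^ 2) ^ n * real q"
      by (simp only: power_mult_distrib[of E] mult_ac)
    then have "(E * (200 * real L)) ^ n \<le> (real q ^ 2) ^ n"
      by (rule mult_right_le_imp_le) (use q1 in simp)
    then have "E * (200 * real L) \<le> real q ^ 2"
      using n1 E0 by (subst (asm) power_mono_iff) auto
    then show "exp_sum_total L {..<Y} (\<lambda>t. poly f (c + real (4 * (2 * i + 1)\<^sup>2) * real t)) * (200 * real L) \<le> real q ^ 2"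
      unfolding E_def .
  qed
  then obtain m where m: "m \<in> {q\<^sup>2..<2 * q\<^sup>2}" "squarefree (4 * m + 2)"
    "dist_nearest_int (poly f (real (4 * m + 2))) < 1 / real L" by blast
  have qm: "q \<le> m" using m(1) power_increasing[of 1 2 q] q1 by simp
  have "1 / real L \<le> 1 / y" using Ly(1) y1 by (intro divide_left_mono) auto
  also have "1 / y = (8 * real q ^ 2) powr (- \<delta>)" by (simp add: y_def powr_minus_divide)
  also have "\<dots> \<le> real (4 * m + 2) powr (- \<delta>)"
  proof (rule powr_mono2')
    have "4 * m + 2 \<le> 8 * q ^ 2" using m(1) by auto
    then have "real (4 * m + 2) \<le> real (8 * q ^ 2)" by (rule of_nat_mono)
    then show "real (4 * m + 2) \<le> 8 * real q ^ 2" by simp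
  qed (use \<delta>0 in auto)
  also have "\<dots> \<le> real (4 * m + 2) powr (- \<gamma> / 4 + \<epsilon>)"
    using \<gamma> \<epsilon>0 by (intro powr_mono) (auto simp: \<delta>_def)
  finally have "dist_nearest_int (poly f (real (4 * m + 2))) < real (4 * m + 2) powr (- \<gamma> / 4 + \<epsilon>)"
    using m(3) by linarith
  moreover have "card (prime_factors (4 * m + 2)) \<ge> 2" using qm q1 by (intro card_prime_factors_ge_2) auto
  moreover have "0 < 4 * m + 2" by simp
  ultimately have "4 * m + 2 \<in> ?S" using m(2) by (intro CollectI conjI)
  then show False using N[of "4 * m + 2"] qm qN by linarith
qed

end
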